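(* Let $(K_n)_{n=1}^\infty$ be the optimal constants satisfying the multilinear Bohnenblust--Hille inequality for complex scalars, and let $\gamma$ be the Euler--Mascheroni constant. For any $\varepsilon>0$, $$K_{n+1}-K_{n}<\left(\frac{4}{\sqrt{\pi}}-\frac{4}{e^{\frac12-\frac12\gamma}\sqrt{\pi}}\right) n^{\log_{2}\left(\frac{e^{\frac12-\frac12\gamma}}{2}\right)+\varepsilon}$$ for infinitely many positive integers $n$. Numerically (choosing a sufficiently small $\varepsilon>0$), $$K_{n+1}-K_n<\frac{0.44}{n^{0.695025}}$$ for infinitely many positive integers $n$.
   Context: For a positive integer $n$, $K_n$ denotes the optimal constant in the complex $n$-linear Bohnenblust--Hille inequality, i.e. the smallest $C\in[1,\infty)$ such that $$\left(\sum_{i_1,\ldots,i_n=1}^N |U(e_{i_1},\ldots,e_{i_n})|^{\frac{2n}{n+1}}\right)^{\frac{n+1}{2n}}\le C\,\sup_{z_1,\ldots,z_n\in\mathbb{D}^N}|U(z_1,\ldots,z_n)|$$ for all positive integers $N$ and all $n$-linear forms $U:\mathbb{C}^N\times\cdots\times\mathbb{C}^N\to\mathbb{C}$, where $(e_i)_{i=1}^N$ is the canonical basis of $\mathbb{C}^N$ and $\mathbb{D}^N$ is the open unit polydisc in $\mathbb{C}^N$. Such finite constants exist (Bohnenblust--Hille theorem). The Euler--Mascheroni constant is $\gamma=\lim_{m\to\infty}\left(-\log m+\sum_{k=1}^m \frac1k\right)\approx0.5772$. *)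

theory Defs
  imports "HOL-Analysis.Harmonic_Numbers" "Jordan_Normal_Form.Matrix"
begin

text \<open>
  Since the degree \<open>n\<close> and the dimension \<open>N\<close> are quantified inside the definition of the
  optimal constants, \<open>\<complex>\<^sup>N\<close> is the carrier \<open>carrier_vec N\<close>, and an \<open>n\<close>-tuple of vectors is an
  extensional function on \<open>{..<n}\<close>.  Indices start at 0 instead of 1.  HOL-Analysis also declares
  a type constructor \<open>vec\<close>, hence the qualified names.
\<close>

definition multilinear_form :: "nat \<Rightarrow> nat \<Rightarrow> ((nat \<Rightarrow> complex Matrix.vec) \<Rightarrow> complex) \<Rightarrow> bool" where
  "multilinear_form n N U \<longleftrightarrow>
    (\<forall>k<n. \<forall>z \<in> {..<n} \<rightarrow>\<^sub>E carrier_vec N.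
      (\<forall>x \<in> carrier_vec N. \<forall>y \<in> carrier_vec N.
        U (z(k := x + y)) = U (z(k := x)) + U (z(k := y))) \<and>
      (\<forall>a. \<forall>x \<in> carrier_vec N. U (z(k := a \<cdot>\<^sub>v x)) = a * U (z(k := x))))"

definition unit_polydisc :: "nat \<Rightarrow> complex Matrix.vec set" where
  "unit_polydisc N = {z \<in> carrier_vec N. \<forall>i<N. cmod (vec_index z i) < 1}"

text \<open>
  The supremum below is over a nonempty set, which is bounded above because a multilinear form on
  a finite-dimensional space is bounded on the polydisc.
\<close>

definition BH_inequality :: "nat \<Rightarrow> real \<Rightarrow> bool" where
  "BH_inequality n C \<longleftrightarrow>
    (\<forall>N\<ge>1. \<forall>U. multilinear_form n N U \<longrightarrow>
      (\<Sum>i \<in> {..<n} \<rightarrow>\<^sub>E {..<N}.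
          cmod (U (\<lambda>k\<in>{..<n}. unit_vec N (i k))) powr (2 * real n / (real n + 1)))
        powr ((real n + 1) / (2 * real n))
      \<le> C * (SUP z \<in> {..<n} \<rightarrow>\<^sub>E unit_polydisc N. cmod (U z)))"

text \<open>
  The least element exists for every \<open>n \<ge> 1\<close>: the set of admissible constants is closed and
  bounded below, and it is nonempty by the Bohnenblust--Hille theorem.  The value at \<open>n = 0\<close> has
  no meaning.
\<close>

definition BH_constant :: "nat \<Rightarrow> real" where
  "BH_constant n = (LEAST C. 1 \<le> C \<and> BH_inequality n C)"

end

theory Submission
  imports Defs "HOL-Analysis.Analysis"
begin

text \<open>
  The increments of \<open>K\<^sub>n = BH_constant n\<close> cannot all be large because \<open>K\<^sub>n\<close> itself grows slowly: if
  \<open>K\<^sub>n\<^sub>+\<^sub>1 - K\<^sub>n \<ge> d n\<^bsup>q-1\<^esup>\<close> for all large \<open>n\<close>, then \<open>K\<^sub>n\<close> is at least a positive multiple of \<open>n\<^bsup>q\<^esup>\<close>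
  (\<open>infinitely_many_small_increments\<close>).  So both claims follow from any bound \<open>K\<^sub>n = O(n\<^bsup>c\<^esup>)\<close> with
  \<open>c\<close> smaller than \<open>(1 - \<gamma>) / (2 ln 2) \<approx> 0.30497\<close> and than \<open>1 - 0.695025 = 0.304975\<close>; the constant
  factors in the claims only have to be positive.  The proof gives \<open>c = 15/56 \<approx> 0.268\<close>.

  The growth bound comes from \<open>K\<^sub>n\<^sub>+\<^sub>1 \<le> exp (c / n) K\<^sub>n\<close> (\<open>BH_inequality_Suc\<close>) and
  \<open>1 + 1/2 + \<dots> + 1/n \<le> 1 + ln n\<close>.  The step follows the argument of Bayart, Pellegrino and
  Seoane-Sepulveda.  With \<open>p = 2n / (n + 1)\<close>, Blei's inequality (\<open>Blei_inequality\<close>) bounds the norm of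
  the coefficients of an \<open>(n+1)\<close>-linear form by the mixed norms in which one index is summed with
  exponent 2 inside and the other \<open>n\<close> with exponent \<open>p\<close> outside.  A Khinchine inequality replaces the
  inner norm by an average over unimodular vectors in one slot, which leaves an \<open>n\<close>-linear form.

  What remains is a Khinchine inequality for exponents close to 2 with a good constant
  (\<open>Khinchine_root5\<close>).  If \<open>S\<close> is a random sum with \<open>E \<bar>S\<bar>\<^sup>2 = 1\<close> and \<open>Y = \<bar>S\<bar>\<^sup>2\<close>, then
  \<open>E Y\<^bsup>1-\<delta>\<^esup> \<ge> exp (- \<delta> E (Y ln Y))\<close>, so the constant is governed by \<open>E (Y ln Y)\<close>.  Comparison with the
  fourth moment of \<open>S\<close> alone gives only \<open>E (Y ln Y) \<le> ln 2\<close>, hence \<open>c = ln 2 / 2 \<approx> 0.347\<close>, which is too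
  large.  Instead \<open>ln y\<close> is majorised by a cubic polynomial (\<open>ln_le_cubic\<close>), and the moments of \<open>Y\<close> up to
  order 4 are computed exactly (\<open>rot_avg_moments\<close>); this gives \<open>15/28\<close> in place of \<open>ln 2\<close>
  (\<open>rot_avg_quartic_le\<close>).
\<close>

section \<open>Hoelder, Jensen and Minkowski inequalities for finite sums\<close>

lemma weighted_AM_GM:
  fixes x :: "'j \<Rightarrow> real"
  assumes "finite J" "\<And>j. j \<in> J \<Longrightarrow> x j \<ge> 0" "\<And>j. j \<in> J \<Longrightarrow> \<theta> j > 0" "(\<Sum>j\<in>J. \<theta> j) = 1"
  shows "(\<Prod>j\<in>J. x j powr \<theta> j) \<le> (\<Sum>j\<in>J. \<theta> j * x j)"
proof (cases "\<exists>j\<in>J. x j = 0")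
  case True
  then have "(\<Prod>j\<in>J. x j powr \<theta> j) = 0" using assms(1) by auto
  moreover have "(\<Sum>j\<in>J. \<theta> j * x j) \<ge> 0" by (intro sum_nonneg mult_nonneg_nonneg) (use assms in \<open>auto simp: less_imp_le\<close>)
  ultimately show ?thesis by simp
next
  case False
  then have pos: "x j > 0" if "j \<in> J" for j using assms(2)[OF that] that by force
  have ne: "J \<noteq> {}" using assms(4) by auto
  have "(\<Sum>j\<in>J. \<theta> j * ln (x j)) \<le> ln (\<Sum>j\<in>J. \<theta> j *\<^sub>R x j)"
    by (rule concave_on_sum[OF assms(1) ne ln_concave assms(4)]) (use assms pos in \<open>auto simp: less_imp_le\<close>)
  moreover have "(\<Sum>j\<in>J. \<theta> j *\<^sub>R x j) > 0"
    using assms(1) ne by (intro sum_pos) (use assms pos in auto)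
  ultimately have "exp (\<Sum>j\<in>J. \<theta> j * ln (x j)) \<le> (\<Sum>j\<in>J. \<theta> j *\<^sub>R x j)"
    using ln_ge_iff by blast
  moreover have "exp (\<Sum>j\<in>J. \<theta> j * ln (x j)) = (\<Prod>j\<in>J. x j powr \<theta> j)"
    using assms(1) pos by (simp add: exp_sum powr_def) (intro prod.cong, auto simp: less_imp_neq[symmetric])
  ultimately show ?thesis by simp
qed

text \<open>
  Divide each family by its sum and apply the weighted AM-GM inequality termwise.  The weights must
  be positive because \<open>0 powr 0 = 0\<close>.
\<close>

lemma Holder_sum:
  fixes F :: "'j \<Rightarrow> 'x \<Rightarrow> real"
  assumes "finite X" "finite J" "\<And>j x. j \<in> J \<Longrightarrow> x \<in> X \<Longrightarrow> F j x \<ge> 0"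
    and \<theta>: "\<And>j. j \<in> J \<Longrightarrow> \<theta> j > 0" "(\<Sum>j\<in>J. \<theta> j) = 1"
  shows "(\<Sum>x\<in>X. \<Prod>j\<in>J. F j x powr \<theta> j) \<le> (\<Prod>j\<in>J. (\<Sum>x\<in>X. F j x) powr \<theta> j)"
proof (cases "\<exists>j\<in>J. (\<Sum>x\<in>X. F j x) = 0")
  case True
  then obtain j where j: "j \<in> J" "(\<Sum>x\<in>X. F j x) = 0" by auto
  then have "F j x = 0" if "x \<in> X" for x using assms that by (simp add: sum_nonneg_eq_0_iff)
  then have "(\<Prod>j\<in>J. F j x powr \<theta> j) = 0" if "x \<in> X" for x using assms(2) j(1) that by force
  then show ?thesis by (simp add: prod_nonneg)
next
  case False
  define S where "S j = (\<Sum>x\<in>X. F j x)" for j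
  have S: "S j > 0" if "j \<in> J" for j
    using False assms(3) that unfolding S_def by (smt (verit) sum_nonneg)
  define P where "P = (\<Prod>j\<in>J. S j powr \<theta> j)"
  have P: "P > 0" unfolding P_def using S by (intro prod_pos) (auto dest: S)
  have *: "(\<Prod>j\<in>J. F j x powr \<theta> j) \<le> P * (\<Sum>j\<in>J. \<theta> j * (F j x / S j))" if "x \<in> X" for x
  proof -
    have "(\<Prod>j\<in>J. F j x powr \<theta> j) = P * (\<Prod>j\<in>J. (F j x / S j) powr \<theta> j)"
      unfolding P_def prod.distrib[symmetric] using that assms(3) S
      by (intro prod.cong) (auto simp: powr_divide less_imp_le dest: S)
    also have "\<dots> \<le> P * (\<Sum>j\<in>J. \<theta> j * (F j x / S j))"
      using P S assms that by (intro mult_left_mono weighted_AM_GM) (auto intro!: divide_nonneg_pos)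
    finally show ?thesis .
  qed
  have "(\<Sum>x\<in>X. \<Prod>j\<in>J. F j x powr \<theta> j) \<le> (\<Sum>x\<in>X. P * (\<Sum>j\<in>J. \<theta> j * (F j x / S j)))"
    by (intro sum_mono *)
  also have "\<dots> = P * (\<Sum>j\<in>J. \<theta> j * ((\<Sum>x\<in>X. F j x) / S j))"
    unfolding sum_distrib_left[symmetric] by (subst sum.swap) (simp add: sum_distrib_left sum_divide_distrib)
  also have "(\<Sum>j\<in>J. \<theta> j * ((\<Sum>x\<in>X. F j x) / S j)) = (\<Sum>j\<in>J. \<theta> j)"
    unfolding S_def[symmetric] using S by (intro sum.cong) (auto simp: less_imp_neq[symmetric])
  finally show ?thesis using \<theta> by (simp add: P_def S_def)
qed

text \<open>
  Convexity of \<open>\<lambda>x. x powr r\<close> on the closed half-line, obtained from the two-factor Hoelder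
  inequality applied to \<open>w t = (w t\<^sup>r)\<^bsup>1/r\<^esup> w\<^bsup>1-1/r\<^esup>\<close>.
\<close>

lemma Jensen_powr_sum:
  fixes w t :: "'y \<Rightarrow> real"
  assumes "finite Y" "\<And>y. y \<in> Y \<Longrightarrow> w y \<ge> 0" "\<And>y. y \<in> Y \<Longrightarrow> t y \<ge> 0" "r > 1"
  shows "(\<Sum>y\<in>Y. w y * t y) powr r \<le> (\<Sum>y\<in>Y. w y) powr (r - 1) * (\<Sum>y\<in>Y. w y * t y powr r)"
proof -
  define F where "F j y = (if j then w y * t y powr r else w y)" for j y
  define \<theta> where "\<theta> j = (if j then 1 / r else 1 - 1 / r)" for j
  have eq: "w y * t y = (\<Prod>j\<in>(UNIV::bool set). F j y powr \<theta> j)" if "y \<in> Y" for y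
  proof -
    have "w y powr (1/r) * w y powr (1 - 1/r) = w y"
      using assms(2)[OF that] by (subst powr_add[symmetric]) (simp add: powr_one)
    then show ?thesis
      using assms that by (simp add: UNIV_bool F_def \<theta>_def powr_mult powr_powr mult.commute mult.left_commute)
  qed
  have "(\<Sum>y\<in>Y. w y * t y) = (\<Sum>y\<in>Y. \<Prod>j\<in>(UNIV::bool set). F j y powr \<theta> j)"
    by (intro sum.cong refl eq)
  also have "\<dots> \<le> (\<Prod>j\<in>(UNIV::bool set). (\<Sum>y\<in>Y. F j y) powr \<theta> j)"
    using assms by (intro Holder_sum) (auto simp: F_def \<theta>_def UNIV_bool)
  finally have "(\<Sum>y\<in>Y. w y * t y) \<le> (\<Prod>j\<in>(UNIV::bool set). (\<Sum>y\<in>Y. F j y) powr \<theta> j)" .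
  then have "(\<Sum>y\<in>Y. w y * t y) powr r \<le> ((\<Sum>y\<in>Y. w y) powr (1 - 1/r) * (\<Sum>y\<in>Y. w y * t y powr r) powr (1/r)) powr r"
    using assms by (intro powr_mono2) (auto simp: UNIV_bool F_def \<theta>_def intro!: sum_nonneg)
  also have "\<dots> = (\<Sum>y\<in>Y. w y) powr (r - 1) * (\<Sum>y\<in>Y. w y * t y powr r)"
    using assms by (simp add: powr_mult powr_powr sum_nonneg algebra_simps)
  finally show ?thesis .
qed

text \<open>
  Moving the larger exponent inwards increases a mixed norm.  Write \<open>h y\<close> for the \<open>p\<close>-th power of the
  \<open>s\<close>-norm of the column \<open>f (\<cdot>, y)\<close>; then \<open>f x y powr p = h y * u\<close>, where the \<open>(s / p)\<close>-th powers of
  the numbers \<open>u\<close> sum to at most 1 in each column, and Jensen's inequality with weights \<open>h\<close> finishes.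
\<close>

lemma Minkowski_mixed:
  fixes f :: "'x \<Rightarrow> 'y \<Rightarrow> real"
  assumes fin: "finite X" "finite Y" and f: "\<And>x y. x \<in> X \<Longrightarrow> y \<in> Y \<Longrightarrow> f x y \<ge> 0"
    and p: "0 < p" "p < s"
  shows "(\<Sum>x\<in>X. (\<Sum>y\<in>Y. f x y powr p) powr (s / p)) powr (1 / s)
    \<le> (\<Sum>y\<in>Y. (\<Sum>x\<in>X. f x y powr s) powr (p / s)) powr (1 / p)"
proof -
  define h where "h y = (\<Sum>x\<in>X. f x y powr s) powr (p / s)" for y
  define H where "H = (\<Sum>y\<in>Y. h y)"
  have h0: "h y \<ge> 0" for y by (simp add: h_def)
  have H0: "H \<ge> 0" unfolding H_def by (intro sum_nonneg h0)
  have eq: "f x y powr p = h y * (f x y powr p / h y)" if "x \<in> X" "y \<in> Y" for x y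
  proof (cases "h y = 0")
    case True
    then have "(\<Sum>x\<in>X. f x y powr s) = 0" by (simp add: h_def)
    then have "f x y = 0" using that fin by (subst (asm) sum_nonneg_eq_0_iff) auto
    then show ?thesis by simp
  qed simp
  have hs: "h y powr (s / p) = (\<Sum>x\<in>X. f x y powr s)" for y
    using p by (simp add: h_def powr_powr sum_nonneg)
  have "(\<Sum>x\<in>X. (\<Sum>y\<in>Y. f x y powr p) powr (s / p))
     \<le> (\<Sum>x\<in>X. H powr (s/p - 1) * (\<Sum>y\<in>Y. h y * (f x y powr p / h y) powr (s/p)))"
  proof (rule sum_mono)
    fix x assume x: "x \<in> X"
    have "(\<Sum>y\<in>Y. f x y powr p) = (\<Sum>y\<in>Y. h y * (f x y powr p / h y))"
      using eq[OF x] by (intro sum.cong) auto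
    then show "(\<Sum>y\<in>Y. f x y powr p) powr (s / p) \<le> H powr (s/p - 1) * (\<Sum>y\<in>Y. h y * (f x y powr p / h y) powr (s/p))"
      unfolding H_def by (simp only:) (intro Jensen_powr_sum, use fin p h0 in auto)
  qed
  also have "\<dots> = H powr (s/p - 1) * (\<Sum>y\<in>Y. h y * (\<Sum>x\<in>X. (f x y powr p / h y) powr (s/p)))"
    unfolding sum_distrib_left[symmetric] by (subst sum.swap) (simp add: sum_distrib_left)
  also have "\<dots> \<le> H powr (s/p - 1) * (\<Sum>y\<in>Y. h y * 1)"
  proof (intro mult_left_mono sum_mono)
    fix y assume y: "y \<in> Y"
    have "(\<Sum>x\<in>X. (f x y powr p / h y) powr (s/p)) = (\<Sum>x\<in>X. f x y powr s / h y powr (s/p))"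
      using p h0 by (intro sum.cong) (auto simp: powr_divide powr_powr)
    also have "\<dots> \<le> 1" unfolding hs sum_divide_distrib[symmetric] by (simp add: divide_le_eq_1 not_less sum_nonneg)
    finally show "(\<Sum>x\<in>X. (f x y powr p / h y) powr (s/p)) \<le> 1" .
  qed (auto simp: h0)
  also have "\<dots> = H powr (s / p)"
  proof -
    have "H powr (s/p - 1) * H powr 1 = H powr (s/p)" by (subst powr_add[symmetric]) simp
    then show ?thesis using H0 by (simp add: H_def)
  qed
  finally have "(\<Sum>x\<in>X. (\<Sum>y\<in>Y. f x y powr p) powr (s / p)) powr (1 / s) \<le> (H powr (s / p)) powr (1 / s)"
    using p by (intro powr_mono2) (auto intro!: sum_nonneg)
  then show ?thesis using p by (simp add: powr_powr H_def h_def)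
qed

section \<open>Mixed norms and Blei's inequality\<close>

text \<open>
  Sums over \<open>PiE\<close> are unfolded one coordinate at a time along a list of coordinates, the head being
  the outermost sum.  Coordinates outside the list keep their value in the base point \<open>y\<close>, so that
  induction on the list can vary \<open>y\<close>.
\<close>

primrec nested_sum :: "'a set \<Rightarrow> 'k list \<Rightarrow> (('k \<Rightarrow> 'a) \<Rightarrow> real) \<Rightarrow> ('k \<Rightarrow> 'a) \<Rightarrow> real" where
  "nested_sum A [] g y = g y"
| "nested_sum A (k # ks) g y = (\<Sum>l\<in>A. nested_sum A ks g (y(k := l)))"

primrec mixed_norm ::
  "'a set \<Rightarrow> ('k \<Rightarrow> real) \<Rightarrow> 'k list \<Rightarrow> (('k \<Rightarrow> 'a) \<Rightarrow> real) \<Rightarrow> ('k \<Rightarrow> 'a) \<Rightarrow> real" where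
  "mixed_norm A r [] f y = f y"
| "mixed_norm A r (k # ks) f y =
    (\<Sum>l\<in>A. mixed_norm A r ks f (y(k := l)) powr r k) powr (1 / r k)"

lemma sum_PiE_insert:
  assumes "k \<notin> S"
  shows "(\<Sum>x\<in>insert k S \<rightarrow>\<^sub>E A. g x) = (\<Sum>l\<in>A. \<Sum>x\<in>S \<rightarrow>\<^sub>E A. g (x(k := l)))"
proof -
  have "inj_on (\<lambda>(l, x). x(k := l)) (A \<times> (S \<rightarrow>\<^sub>E A))" using inj_combinator[OF assms, of "\<lambda>_. A"] by simp
  then show ?thesis
    unfolding PiE_insert_eq by (subst sum.reindex) (simp_all add: sum.cartesian_product case_prod_beta o_def)
qed

lemma nested_sum_PiE:
  "distinct ks \<Longrightarrow>
    nested_sum A ks g y = (\<Sum>x\<in>set ks \<rightarrow>\<^sub>E A. g (override_on y x (set ks)))"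
proof (induction ks arbitrary: y)
  case (Cons k ks)
  have "override_on (y(k := l)) x (set ks) = override_on y (x(k := l)) (set (k # ks))" for l x
    using Cons.prems by (auto simp: override_on_def)
  then show ?case using Cons by (simp add: sum_PiE_insert)
qed simp

lemma nested_sum_append: "nested_sum A (ks @ ls) g y = nested_sum A ks (nested_sum A ls g) y"
  by (induction ks arbitrary: y) simp_all

lemma nested_sum_nonneg: "(\<And>x. g x \<ge> 0) \<Longrightarrow> nested_sum A ks g y \<ge> 0"
  by (induction ks arbitrary: y) (auto intro: sum_nonneg)

lemma mixed_norm_append:
  "mixed_norm A r (ks @ ls) f y = mixed_norm A r ks (mixed_norm A r ls f) y"
  by (induction ks arbitrary: y) simp_all

lemma mixed_norm_nonneg: "(\<And>x. f x \<ge> 0) \<Longrightarrow> mixed_norm A r ks f y \<ge> 0"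
  by (cases ks) simp_all

lemma mixed_norm_mono:
  assumes "\<And>x. 0 \<le> f x" "\<And>x. f x \<le> g x" "\<And>k. k \<in> set ks \<Longrightarrow> r k > 0"
  shows "mixed_norm A r ks f y \<le> mixed_norm A r ks g y"
  using assms(3)
proof (induction ks arbitrary: y)
  case (Cons k ks)
  then have "r k \<ge> 0" by (simp add: less_imp_le)
  then show ?case using Cons
    by (auto intro!: powr_mono2 sum_mono sum_nonneg mixed_norm_nonneg assms(1))
qed (simp add: assms)

lemma mixed_norm_const:
  assumes "\<And>k. k \<in> set ks \<Longrightarrow> r k = p" "p > 0" "\<And>x. f x \<ge> 0"
  shows "mixed_norm A r ks f y = nested_sum A ks (\<lambda>x. f x powr p) y powr (1 / p)"
  using assms(1)
proof (induction ks arbitrary: y)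
  case Nil
  then show ?case using assms by (simp add: powr_powr)
next
  case (Cons k ks)
  then show ?case using assms by (simp add: powr_powr nested_sum_nonneg)
qed

text \<open>
  Mixed norms are logarithmically convex in the reciprocals of the exponents: one application of the
  Hoelder inequality for each coordinate.
\<close>

lemma mixed_norm_Holder:
  assumes A: "finite A" and J: "finite J" and F: "\<And>j x. j \<in> J \<Longrightarrow> F j x \<ge> 0"
    and \<theta>: "\<And>j. j \<in> J \<Longrightarrow> \<theta> j > 0"
    and r: "\<And>j k. j \<in> J \<Longrightarrow> k \<in> set ks \<Longrightarrow> r j k > 0"
    and q: "\<And>k. k \<in> set ks \<Longrightarrow> q k > 0" "\<And>k. k \<in> set ks \<Longrightarrow> 1 / q k = (\<Sum>j\<in>J. \<theta> j / r j k)"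
  shows "mixed_norm A q ks (\<lambda>x. \<Prod>j\<in>J. F j x powr \<theta> j) y
    \<le> (\<Prod>j\<in>J. mixed_norm A (r j) ks (F j) y powr \<theta> j)"
  using r q
proof (induction ks arbitrary: y)
  case (Cons k ks)
  define G where "G j l = mixed_norm A (r j) ks (F j) (y(k := l))" for j l
  have G: "G j l \<ge> 0" if "j \<in> J" for j l unfolding G_def by (intro mixed_norm_nonneg F that)
  have qk: "q k > 0" using Cons.prems by simp
  have rk: "r j k > 0" if "j \<in> J" for j using Cons.prems that by simp
  have sum1: "(\<Sum>j\<in>J. \<theta> j * q k / r j k) = 1"
  proof -
    have "(\<Sum>j\<in>J. \<theta> j * q k / r j k) = q k * (\<Sum>j\<in>J. \<theta> j / r j k)"
      by (simp add: sum_distrib_left mult.commute)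
    also have "\<dots> = q k * (1 / q k)" using Cons.prems(3)[of k] by simp
    finally show ?thesis using qk by simp
  qed
  have "(\<Sum>l\<in>A. mixed_norm A q ks (\<lambda>x. \<Prod>j\<in>J. F j x powr \<theta> j) (y(k := l)) powr q k)
     \<le> (\<Sum>l\<in>A. (\<Prod>j\<in>J. G j l powr \<theta> j) powr q k)"
    unfolding G_def using Cons less_imp_le[OF qk]
    by (intro sum_mono powr_mono2 mixed_norm_nonneg prod_nonneg) auto
  also have "\<dots> = (\<Sum>l\<in>A. \<Prod>j\<in>J. (G j l powr r j k) powr (\<theta> j * q k / r j k))"
  proof (intro sum.cong refl)
    fix l
    have "(\<Prod>j\<in>J. G j l powr \<theta> j) powr q k = (\<Prod>j\<in>J. (G j l powr \<theta> j) powr q k)"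
      using J by (induction J rule: finite_induct) (auto simp: powr_mult prod_nonneg)
    also have "\<dots> = (\<Prod>j\<in>J. (G j l powr r j k) powr (\<theta> j * q k / r j k))"
      by (intro prod.cong) (use rk in \<open>auto simp: powr_powr less_imp_neq[symmetric]\<close>)
    finally show "(\<Prod>j\<in>J. G j l powr \<theta> j) powr q k = (\<Prod>j\<in>J. (G j l powr r j k) powr (\<theta> j * q k / r j k))" .
  qed
  also have "\<dots> \<le> (\<Prod>j\<in>J. (\<Sum>l\<in>A. G j l powr r j k) powr (\<theta> j * q k / r j k))"
    using A J \<theta> qk rk sum1 by (intro Holder_sum) auto
  finally have "mixed_norm A q (k # ks) (\<lambda>x. \<Prod>j\<in>J. F j x powr \<theta> j) y
     \<le> (\<Prod>j\<in>J. (\<Sum>l\<in>A. G j l powr r j k) powr (\<theta> j * q k / r j k)) powr (1 / q k)"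
    using qk by (auto intro!: powr_mono2 sum_nonneg)
  also have "\<dots> = (\<Prod>j\<in>J. ((\<Sum>l\<in>A. G j l powr r j k) powr (\<theta> j * q k / r j k)) powr (1 / q k))"
    using J by (induction J rule: finite_induct) (auto simp: powr_mult prod_nonneg)
  also have "\<dots> = (\<Prod>j\<in>J. mixed_norm A (r j) (k # ks) (F j) y powr \<theta> j)"
    using qk by (intro prod.cong) (auto simp: powr_powr G_def)
  finally show ?case .
qed simp

text \<open>
  An exceptional exponent \<open>s > p\<close> may be moved from its place to the innermost place; the coordinates
  after it carry the common exponent \<open>p\<close> and act as a single sum, so one use of
  \<open>Minkowski_mixed\<close> suffices.
\<close>

lemma mixed_norm_single_exponent:
  assumes A: "finite A" and d: "distinct (ks @ j # ls)"
    and r: "r j = s" "\<And>k. k \<in> set ks \<union> set ls \<Longrightarrow> r k = p" and p: "0 < p" "p < s"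
    and f: "\<And>x. f x \<ge> 0"
  shows "mixed_norm A r (ks @ j # ls) f y
    \<le> nested_sum A (ks @ ls) (\<lambda>x. (\<Sum>l\<in>A. f (x(j := l)) powr s) powr (p / s)) y powr (1 / p)"
proof -
  define g where "g x = (\<Sum>l\<in>A. f (x(j := l)) powr s) powr (p / s)" for x
  have g: "g x \<ge> 0" for x by (simp add: g_def)
  have inner: "mixed_norm A r (j # ls) f y \<le> nested_sum A ls g y powr (1 / p)" for y
  proof -
    have ov: "override_on (y(j := l)) x (set ls) = (override_on y x (set ls))(j := l)" for l x
      using d by (auto simp: override_on_def)
    have "mixed_norm A r (j # ls) f y =
      (\<Sum>l\<in>A. (\<Sum>x\<in>set ls \<rightarrow>\<^sub>E A. f ((override_on y x (set ls))(j := l)) powr p) powr (s / p)) powr (1 / s)"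
      using r d p f by (simp add: mixed_norm_const[of ls r p] powr_powr sum_nonneg nested_sum_nonneg nested_sum_PiE ov)
    also have "\<dots> \<le> (\<Sum>x\<in>set ls \<rightarrow>\<^sub>E A. (\<Sum>l\<in>A. f ((override_on y x (set ls))(j := l)) powr s) powr (p / s)) powr (1 / p)"
      using A p f by (intro Minkowski_mixed) (auto intro: finite_PiE)
    also have "\<dots> = nested_sum A ls g y powr (1 / p)"
      using d by (simp add: nested_sum_PiE g_def)
    finally show ?thesis .
  qed
  have "mixed_norm A r (ks @ j # ls) f y \<le> mixed_norm A r ks (\<lambda>y. nested_sum A ls g y powr (1 / p)) y"
    unfolding mixed_norm_append using r p inner
    by (intro mixed_norm_mono mixed_norm_nonneg f) auto
  also have "\<dots> = nested_sum A (ks @ ls) g y powr (1 / p)"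
    using r p g by (subst mixed_norm_const[of ks r p]) (auto simp: powr_powr nested_sum_append nested_sum_nonneg)
  finally show ?thesis unfolding g_def .
qed

text \<open>
  The number \<open>1 / q\<close> is the average over \<open>j \<in> I\<close> of the reciprocal exponents of the mixed norms with
  2 in coordinate \<open>j\<close> and \<open>p\<close> elsewhere: \<open>1 / q = (n / p + 1 / 2) / (n + 1)\<close>.  Hence the \<open>q\<close>-norm is at
  most the geometric mean of these mixed norms, each of which is at most \<open>M\<close>.
\<close>

theorem Blei_inequality:
  fixes f :: "('k \<Rightarrow> 'a) \<Rightarrow> real"
  assumes A: "finite A" and I: "finite I" "card I = Suc n" "n \<ge> 1"
    and f: "\<And>x. f x \<ge> 0" and M: "M \<ge> 0"
    and p: "p = 2 * real n / (real n + 1)" and q: "q = 2 * real (Suc n) / (real (Suc n) + 1)"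
    and bound: "\<And>j. j \<in> I \<Longrightarrow>
      (\<Sum>x\<in>(I - {j}) \<rightarrow>\<^sub>E A. (\<Sum>l\<in>A. (f (x(j := l)))\<^sup>2) powr (p / 2)) \<le> M powr p"
  shows "(\<Sum>x\<in>I \<rightarrow>\<^sub>E A. f x powr q) powr (1 / q) \<le> M"
proof -
  obtain ks where ks: "set ks = I" "distinct ks" using finite_distinct_list[OF I(1)] by auto
  define y :: "'k \<Rightarrow> 'a" where "y = (\<lambda>_. undefined)"
  define r :: "'k \<Rightarrow> 'k \<Rightarrow> real" where "r j k = (if k = j then 2 else p)" for j k
  define \<theta> where "\<theta> = 1 / real (Suc n)"
  have p0: "p > 0" "p < 2" and q0: "q > 0" using I(3) by (auto simp: p q divide_simps)
  have ov: "override_on y x S = x" if "x \<in> S \<rightarrow>\<^sub>E A" for x S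
    using that by (auto simp: override_on_def y_def PiE_def extensional_def)
  have f_eq: "f x = (\<Prod>j\<in>I. f x powr \<theta>)" for x
  proof -
    have "(\<Prod>j\<in>I. f x powr \<theta>) = (f x powr \<theta>) powr real (Suc n)"
      using I(2) by (cases "f x = 0") (simp_all add: powr_realpow del: power_Suc of_nat_Suc)
    then show ?thesis using f[of x] by (simp add: powr_powr \<theta>_def)
  qed
  have exps: "1 / q = (\<Sum>j\<in>I. \<theta> / r j k)" if "k \<in> I" for k
  proof -
    have "(\<Sum>j\<in>I. \<theta> / r j k) = \<theta> / 2 + (\<Sum>j\<in>I - {k}. \<theta> / r j k)"
      using that I(1) by (subst sum.remove[of _ k]) (auto simp: r_def)
    also have "(\<Sum>j\<in>I - {k}. \<theta> / r j k) = (\<Sum>j\<in>I - {k}. \<theta> / p)"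
      by (intro sum.cong) (auto simp: r_def)
    also have "\<dots> = real n * \<theta> / p" using that I by simp
    finally show ?thesis using I(3) by (simp add: p q \<theta>_def divide_simps) (simp add: algebra_simps)
  qed
  have slot: "mixed_norm A (r j) ks f y \<le> M" if j: "j \<in> I" for j
  proof -
    obtain as bs where s: "ks = as @ j # bs" using j ks(1) by (metis split_list)
    have I_eq: "set as \<union> set bs = I - {j}" using ks unfolding s by auto
    have "mixed_norm A (r j) ks f y
      \<le> nested_sum A (as @ bs) (\<lambda>x. (\<Sum>l\<in>A. f (x(j := l)) powr 2) powr (p / 2)) y powr (1 / p)"
      unfolding s using A ks(2) p0 f by (intro mixed_norm_single_exponent) (auto simp: s r_def)
    also have "nested_sum A (as @ bs) (\<lambda>x. (\<Sum>l\<in>A. f (x(j := l)) powr 2) powr (p / 2)) y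
      = (\<Sum>x\<in>(I - {j}) \<rightarrow>\<^sub>E A. (\<Sum>l\<in>A. (f (x(j := l)))\<^sup>2) powr (p / 2))"
    proof -
      have set_eq: "set (as @ bs) = I - {j}" and dist: "distinct (as @ bs)" using ks(2) I_eq s by auto
      have sq: "f z powr 2 = (f z)\<^sup>2" for z using f[of z] by simp
      show ?thesis unfolding nested_sum_PiE[OF dist] set_eq sq by (intro sum.cong refl) (simp only: ov)
    qed
    also have "\<dots> powr (1 / p) \<le> (M powr p) powr (1 / p)"
      using p0 by (intro powr_mono2[OF _ _ bound[OF j]] sum_nonneg) simp_all
    also have "\<dots> = M" using M p0 by (simp add: powr_powr)
    finally show ?thesis .
  qed
  have "(\<Sum>x\<in>I \<rightarrow>\<^sub>E A. f x powr q) powr (1 / q) = mixed_norm A (\<lambda>_. q) ks f y"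
    using ks q0 f by (subst mixed_norm_const) (auto simp: nested_sum_PiE ov intro!: sum.cong arg_cong[where f = "\<lambda>t. t powr _"])
  also have "\<dots> = mixed_norm A (\<lambda>_. q) ks (\<lambda>x. \<Prod>j\<in>I. f x powr \<theta>) y"
    by (simp only: f_eq[symmetric])
  also have "\<dots> \<le> (\<Prod>j\<in>I. mixed_norm A (r j) ks f y powr \<theta>)"
    using A I(1) f q0 p0 exps ks by (intro mixed_norm_Holder) (auto simp: r_def \<theta>_def)
  also have "\<dots> \<le> (\<Prod>j\<in>I. M powr \<theta>)"
    using slot f by (intro prod_mono) (auto simp: \<theta>_def intro!: powr_mono2 mixed_norm_nonneg)
  also have "\<dots> = M"
  proof -
    have "(\<Prod>j\<in>I. M powr \<theta>) = (M powr \<theta>) powr real (Suc n)"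
      using I(2) by (cases "M = 0") (simp_all add: powr_realpow del: power_Suc of_nat_Suc)
    then show ?thesis using M by (simp add: powr_powr \<theta>_def)
  qed
  finally show ?thesis .
qed

section \<open>A Khinchine inequality near exponent 2\<close>

text \<open>
  Five is the smallest order for which the powers \<open>\<epsilon>, \<dots>, \<epsilon>\<^sup>4\<close> of a random root of unity have mean zero,
  so the first four moments of \<open>\<bar>x + a \<epsilon>\<bar>\<^sup>2\<close> are those of a rotation uniform on the circle, while all
  averages remain finite sums.
\<close>

definition root5 :: complex where
  "root5 = cis (2 * pi / 5)"

lemma cmod_root5_power [simp]: "cmod (root5 ^ k) = 1"
  by (simp add: root5_def norm_power)

lemma root5_power5: "root5 ^ 5 = 1"
  using Complex.DeMoivre[of "2 * pi / 5" 5] by (simp add: root5_def)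

lemma root5_neq_1: "root5 \<noteq> 1"
proof
  assume "root5 = 1"
  then have "cos (2 * pi / 5) = 1" by (simp add: root5_def complex_eq_iff)
  moreover have "cos (2 * pi / 5) < cos 0" by (rule cos_monotone_0_pi) auto
  ultimately show False by simp
qed

lemma sum_root5_powers:
  assumes "0 < j" "j < 5"
  shows "(\<Sum>k<5. (root5 ^ k) ^ j) = 0"
proof -
  have neq: "root5 ^ j \<noteq> 1"
  proof
    assume j: "root5 ^ j = 1"
    \<comment> \<open>\<open>j\<close> is invertible modulo 5\<close>
    have "root5 ^ (j * (j ^ 3)) = 1" by (simp add: power_mult j)
    moreover have "j * j ^ 3 = 5 * (j ^ 4 div 5) + 1"
    proof -
      have "j \<in> {1, 2, 3, 4}" using assms by auto
      then show ?thesis by auto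
    qed
    ultimately have "root5 = 1" by (simp only: power_add power_mult root5_power5) simp
    with root5_neq_1 show False by simp
  qed
  have "(\<Sum>k<5. (root5 ^ k) ^ j) = (\<Sum>k<5. (root5 ^ j) ^ k)"
    by (simp add: power_mult[symmetric] mult.commute)
  also have "\<dots> = ((root5 ^ j) ^ 5 - 1) / (root5 ^ j - 1)" using neq by (rule geometric_sum)
  also have "(root5 ^ j) ^ 5 = 1"
    by (metis mult.commute power_mult power_one root5_power5)
  finally show ?thesis by simp
qed

text \<open>
  With \<open>v\<close> the conjugate of \<open>u\<close> and \<open>c + W u + V v = \<bar>x + a u\<bar>\<^sup>2\<close>, these expansions collect the powers
  of \<open>u\<close> and \<open>v\<close>, all of which average to zero over the fifth roots of unity.
\<close>

lemma rotated_square: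
  fixes c W V u v :: complex
  assumes "u * v = 1"
  shows "(c + W * u + V * v) ^ 2 = (c^2 + 2 * (W * V)) + (2 * c * W) * u + (2 * c * V) * v
       + W^2 * u ^ 2 + V^2 * v ^ 2"
  using assms by Groebner_Basis.algebra

lemma rotated_cube:
  fixes c W V u v :: complex
  assumes "u * v = 1"
  shows "(c + W * u + V * v) ^ 3 = (c^3 + 6 * c * (W * V)) + (3 * c^2 * W + 3 * W * (W * V)) * u
       + (3 * c^2 * V + 3 * V * (W * V)) * v
       + (3 * c * W^2) * u ^ 2 + (3 * c * V^2) * v ^ 2 + W^3 * u ^ 3 + V^3 * v ^ 3"
  using assms by Groebner_Basis.algebra

lemma rotated_fourth_power:
  fixes c W V u v :: complex
  assumes "u * v = 1"
  shows "(c + W * u + V * v) ^ 4 = (c^4 + 12 * c^2 * (W * V) + 6 * (W * V)^2)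
       + (4 * c^3 * W + 12 * c * W * (W * V)) * u + (4 * c^3 * V + 12 * c * V * (W * V)) * v
       + (6 * c^2 * W^2 + 4 * W^2 * (W * V)) * u ^ 2 + (6 * c^2 * V^2 + 4 * V^2 * (W * V)) * v ^ 2
       + (4 * c * W^3) * u ^ 3 + (4 * c * V^3) * v ^ 3 + W^4 * u ^ 4 + V^4 * v ^ 4"
  using assms by Groebner_Basis.algebra

lemma circle_power_sums:
  fixes x a :: complex
  defines "X \<equiv> (cmod x)\<^sup>2" and "s \<equiv> (cmod a)\<^sup>2"
  shows "(\<Sum>k<5. (cmod (x + a * root5 ^ k))\<^sup>2) = 5 * (X + s)"
    and "(\<Sum>k<5. ((cmod (x + a * root5 ^ k))\<^sup>2) ^ 2) = 5 * (X^2 + 4 * X * s + s^2)"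
    and "(\<Sum>k<5. ((cmod (x + a * root5 ^ k))\<^sup>2) ^ 3) = 5 * (X^3 + 9 * X^2 * s + 9 * X * s^2 + s^3)"
    and "(\<Sum>k<5. ((cmod (x + a * root5 ^ k))\<^sup>2) ^ 4)
           = 5 * (X^4 + 16 * X^3 * s + 36 * X^2 * s^2 + 16 * X * s^3 + s^4)"
proof -
  define u where "u k = root5 ^ k" for k
  define v where "v k = cnj (root5 ^ k)" for k
  define c where "c = complex_of_real (X + s)"
  define W where "W = cnj x * a"
  define V where "V = x * cnj a"
  have uv: "u k * v k = 1" for k
    unfolding u_def v_def complex_norm_square[symmetric] by simp
  have WV: "W * V = complex_of_real (X * s)"
    unfolding W_def V_def X_def s_def of_real_mult complex_norm_square by (simp add: mult_ac)
  have u: "(\<Sum>k<5. u k ^ j) = 0" if "0 < j" "j < 5" for j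
    unfolding u_def using that by (rule sum_root5_powers)
  have v: "(\<Sum>k<5. v k ^ j) = 0" if "0 < j" "j < 5" for j
  proof -
    have "(\<Sum>k<5. v k ^ j) = cnj (\<Sum>k<5. u k ^ j)" by (simp add: u_def v_def)
    then show ?thesis using u[OF that] by simp
  qed
  have Y: "complex_of_real ((cmod (x + a * root5 ^ k))\<^sup>2) = c + W * u k + V * v k" for k
  proof -
    have "complex_of_real ((cmod (x + a * root5 ^ k))\<^sup>2)
       = x * cnj x + (a * cnj a) * (u k * v k) + W * u k + V * v k"
      unfolding complex_norm_square by (simp add: u_def v_def W_def V_def algebra_simps)
    then show ?thesis unfolding uv c_def X_def s_def of_real_add complex_norm_square by simp
  qed
  note sums = sum.distrib sum_distrib_left[symmetric] u[of 1, simplified] u[of 2] u[of 3] u[of 4]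
    v[of 1, simplified] v[of 2] v[of 3] v[of 4]
  have "complex_of_real (\<Sum>k<5. (cmod (x + a * root5 ^ k))\<^sup>2) = (\<Sum>k<5. c + W * u k + V * v k)"
    by (simp only: of_real_sum Y)
  also have "\<dots> = complex_of_real (5 * (X + s))"
    by (simp add: sums c_def)
  finally show "(\<Sum>k<5. (cmod (x + a * root5 ^ k))\<^sup>2) = 5 * (X + s)"
    by (simp only: of_real_eq_iff)
  have "complex_of_real (\<Sum>k<5. ((cmod (x + a * root5 ^ k))\<^sup>2) ^ 2)
      = (\<Sum>k<5. (c + W * u k + V * v k) ^ 2)"
    by (simp only: of_real_sum of_real_power[of "_ ^ 2"] Y)
  also have "\<dots> = (\<Sum>k<5. (c^2 + 2 * (W * V)) + (2 * c * W) * u k + (2 * c * V) * v k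
       + W^2 * u k ^ 2 + V^2 * v k ^ 2)"
    by (intro sum.cong refl rotated_square uv)
  also have "\<dots> = complex_of_real (5 * (X^2 + 4 * X * s + s^2))"
    by (simp add: sums c_def WV) Groebner_Basis.algebra
  finally show "(\<Sum>k<5. ((cmod (x + a * root5 ^ k))\<^sup>2) ^ 2) = 5 * (X^2 + 4 * X * s + s^2)"
    by (simp only: of_real_eq_iff)
  have "complex_of_real (\<Sum>k<5. ((cmod (x + a * root5 ^ k))\<^sup>2) ^ 3)
      = (\<Sum>k<5. (c + W * u k + V * v k) ^ 3)"
    by (simp only: of_real_sum of_real_power[of "_ ^ 2"] Y)
  also have "\<dots> = (\<Sum>k<5. (c^3 + 6 * c * (W * V)) + (3 * c^2 * W + 3 * W * (W * V)) * u k
       + (3 * c^2 * V + 3 * V * (W * V)) * v k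
       + (3 * c * W^2) * u k ^ 2 + (3 * c * V^2) * v k ^ 2 + W^3 * u k ^ 3 + V^3 * v k ^ 3)"
    by (intro sum.cong refl rotated_cube uv)
  also have "\<dots> = complex_of_real (5 * (X^3 + 9 * X^2 * s + 9 * X * s^2 + s^3))"
    by (simp add: sums c_def WV) Groebner_Basis.algebra
  finally show "(\<Sum>k<5. ((cmod (x + a * root5 ^ k))\<^sup>2) ^ 3)
      = 5 * (X^3 + 9 * X^2 * s + 9 * X * s^2 + s^3)"
    by (simp only: of_real_eq_iff)
  have "complex_of_real (\<Sum>k<5. ((cmod (x + a * root5 ^ k))\<^sup>2) ^ 4)
      = (\<Sum>k<5. (c + W * u k + V * v k) ^ 4)"
    by (simp only: of_real_sum of_real_power[of "_ ^ 2"] Y)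
  also have "\<dots> = (\<Sum>k<5. (c^4 + 12 * c^2 * (W * V) + 6 * (W * V)^2)
       + (4 * c^3 * W + 12 * c * W * (W * V)) * u k + (4 * c^3 * V + 12 * c * V * (W * V)) * v k
       + (6 * c^2 * W^2 + 4 * W^2 * (W * V)) * u k ^ 2 + (6 * c^2 * V^2 + 4 * V^2 * (W * V)) * v k ^ 2
       + (4 * c * W^3) * u k ^ 3 + (4 * c * V^3) * v k ^ 3 + W^4 * u k ^ 4 + V^4 * v k ^ 4)"
    by (intro sum.cong refl rotated_fourth_power uv)
  also have "\<dots> = complex_of_real (5 * (X^4 + 16 * X^3 * s + 36 * X^2 * s^2 + 16 * X * s^3 + s^4))"
    by (simp add: sums c_def WV) Groebner_Basis.algebra
  finally show "(\<Sum>k<5. ((cmod (x + a * root5 ^ k))\<^sup>2) ^ 4)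
      = 5 * (X^4 + 16 * X^3 * s + 36 * X^2 * s^2 + 16 * X * s^3 + s^4)"
    by (simp only: of_real_eq_iff)
qed

text \<open>
  Expectation over independent uniform fifth roots of unity in the coordinates below \<open>N\<close>; the value 1
  in the other coordinates keeps all entries unimodular.
\<close>

primrec rot_avg :: "nat \<Rightarrow> ((nat \<Rightarrow> complex) \<Rightarrow> real) \<Rightarrow> real" where
  "rot_avg 0 f = f (\<lambda>_. 1)"
| "rot_avg (Suc N) f = rot_avg N (\<lambda>\<epsilon>. (\<Sum>k<5. f (\<epsilon>(N := root5 ^ k))) / 5)"

lemma rot_avg_add: "rot_avg N (\<lambda>\<epsilon>. f \<epsilon> + g \<epsilon>) = rot_avg N f + rot_avg N g"
  by (induction N arbitrary: f g) (simp_all add: sum.distrib add_divide_distrib)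

lemma rot_avg_cmult: "rot_avg N (\<lambda>\<epsilon>. c * f \<epsilon>) = c * rot_avg N f"
proof (induction N arbitrary: f)
  case (Suc N)
  show ?case by (simp only: rot_avg.simps sum_distrib_left[symmetric] times_divide_eq_right[symmetric] Suc)
qed simp

lemma rot_avg_const: "rot_avg N (\<lambda>\<epsilon>. c) = c"
  by (induction N) simp_all

lemma rot_avg_diff: "rot_avg N (\<lambda>\<epsilon>. f \<epsilon> - g \<epsilon>) = rot_avg N f - rot_avg N g"
  using rot_avg_add[of N f "\<lambda>\<epsilon>. (-1) * g \<epsilon>"] by (simp only: rot_avg_cmult) simp

lemma rot_avg_sum: "finite X \<Longrightarrow> rot_avg N (\<lambda>\<epsilon>. \<Sum>x\<in>X. f x \<epsilon>) = (\<Sum>x\<in>X. rot_avg N (f x))"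
  by (induction X rule: finite_induct) (simp_all add: rot_avg_const rot_avg_add)

lemma rot_avg_mono:
  assumes "\<And>\<epsilon>. (\<forall>l. cmod (\<epsilon> l) = 1) \<Longrightarrow> f \<epsilon> \<le> g \<epsilon>"
  shows "rot_avg N f \<le> rot_avg N g"
  using assms
proof (induction N arbitrary: f g)
  case (Suc N)
  show ?case unfolding rot_avg.simps
    by (intro Suc.IH divide_right_mono sum_mono Suc.prems) auto
qed simp

lemma third_moment_step:
  fixes s1 s2 s3 b :: real
  shows "6 * s1 ^ 3 - 9 * s1 * s2 + 4 * s3 + 9 * b * (2 * s1^2 - s2) + 9 * b^2 * s1 + b ^ 3
    = 6 * (s1 + b) ^ 3 - 9 * (s1 + b) * (s2 + b^2) + 4 * (s3 + b ^ 3)"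
  by (simp add: power2_eq_square power3_eq_cube algebra_simps)

lemma fourth_moment_step:
  fixes s1 s2 s3 s4 b :: real
  shows "24 * s1 ^ 4 - 72 * s1^2 * s2 + 64 * s1 * s3 + 18 * s2^2 - 33 * s4
      + 16 * b * (6 * s1 ^ 3 - 9 * s1 * s2 + 4 * s3) + 36 * b^2 * (2 * s1^2 - s2) + 16 * b ^ 3 * s1 + b ^ 4
    = 24 * (s1 + b) ^ 4 - 72 * (s1 + b)^2 * (s2 + b^2) + 64 * (s1 + b) * (s3 + b ^ 3)
      + 18 * (s2 + b^2)^2 - 33 * (s4 + b ^ 4)"
  by (simp add: power2_eq_square power3_eq_cube power4_eq_xxxx algebra_simps)

text \<open>
  Adding one summand turns each moment into a combination of lower ones by \<open>circle_power_sums\<close>; the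
  leading terms \<open>k! s\<^sub>1\<^sup>k\<close> are the moments of the exponential distribution, that is, of the squared
  modulus of a complex Gaussian.
\<close>

lemma rot_avg_moments:
  fixes a :: "nat \<Rightarrow> complex"
  defines "Y \<equiv> \<lambda>N \<epsilon>. (cmod (\<Sum>l<N. a l * \<epsilon> l))\<^sup>2"
    and "s \<equiv> \<lambda>k N. \<Sum>l<N. ((cmod (a l))\<^sup>2) ^ k"
  shows "rot_avg N (\<lambda>\<epsilon>. Y N \<epsilon>) = s 1 N"
    and "rot_avg N (\<lambda>\<epsilon>. Y N \<epsilon> ^ 2) = 2 * s 1 N ^ 2 - s 2 N"
    and "rot_avg N (\<lambda>\<epsilon>. Y N \<epsilon> ^ 3) = 6 * s 1 N ^ 3 - 9 * s 1 N * s 2 N + 4 * s 3 N"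
    and "rot_avg N (\<lambda>\<epsilon>. Y N \<epsilon> ^ 4) = 24 * s 1 N ^ 4 - 72 * s 1 N ^ 2 * s 2 N
           + 64 * s 1 N * s 3 N + 18 * s 2 N ^ 2 - 33 * s 4 N"
proof -
  have step: "(cmod (\<Sum>l<Suc N. a l * (\<epsilon>(N := z)) l))\<^sup>2 = (cmod ((\<Sum>l<N. a l * \<epsilon> l) + a N * z))\<^sup>2" for N \<epsilon> z
    by simp
  define b where "b N = (cmod (a N))\<^sup>2" for N
  have s_Suc: "s k (Suc N) = s k N + b N ^ k" for k N by (simp add: s_def b_def)
  have 1: "rot_avg (Suc N) (\<lambda>\<epsilon>. Y (Suc N) \<epsilon>) = rot_avg N (\<lambda>\<epsilon>. Y N \<epsilon> + b N)" for N
    unfolding rot_avg.simps Y_def step circle_power_sums b_def by (simp add: add_divide_distrib)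
  have 2: "rot_avg (Suc N) (\<lambda>\<epsilon>. Y (Suc N) \<epsilon> ^ 2)
     = rot_avg N (\<lambda>\<epsilon>. Y N \<epsilon> ^ 2 + (4 * b N) * Y N \<epsilon> + b N ^ 2)" for N
    unfolding rot_avg.simps Y_def step circle_power_sums b_def
    by (intro arg_cong[where f = "rot_avg N"] ext) (simp add: algebra_simps)
  have 3: "rot_avg (Suc N) (\<lambda>\<epsilon>. Y (Suc N) \<epsilon> ^ 3)
     = rot_avg N (\<lambda>\<epsilon>. Y N \<epsilon> ^ 3 + (9 * b N) * Y N \<epsilon> ^ 2 + (9 * b N ^ 2) * Y N \<epsilon> + b N ^ 3)" for N
    unfolding rot_avg.simps Y_def step circle_power_sums b_def
    by (intro arg_cong[where f = "rot_avg N"] ext) (simp add: algebra_simps)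
  have 4: "rot_avg (Suc N) (\<lambda>\<epsilon>. Y (Suc N) \<epsilon> ^ 4)
     = rot_avg N (\<lambda>\<epsilon>. Y N \<epsilon> ^ 4 + (16 * b N) * Y N \<epsilon> ^ 3 + (36 * b N ^ 2) * Y N \<epsilon> ^ 2
        + (16 * b N ^ 3) * Y N \<epsilon> + b N ^ 4)" for N
    unfolding rot_avg.simps Y_def step circle_power_sums b_def
    by (intro arg_cong[where f = "rot_avg N"] ext) (simp add: algebra_simps)
  have "rot_avg N (\<lambda>\<epsilon>. Y N \<epsilon>) = s 1 N \<and>
    rot_avg N (\<lambda>\<epsilon>. Y N \<epsilon> ^ 2) = 2 * s 1 N ^ 2 - s 2 N \<and>
    rot_avg N (\<lambda>\<epsilon>. Y N \<epsilon> ^ 3) = 6 * s 1 N ^ 3 - 9 * s 1 N * s 2 N + 4 * s 3 N \<and>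
    rot_avg N (\<lambda>\<epsilon>. Y N \<epsilon> ^ 4) = 24 * s 1 N ^ 4 - 72 * s 1 N ^ 2 * s 2 N
           + 64 * s 1 N * s 3 N + 18 * s 2 N ^ 2 - 33 * s 4 N"
  proof (induction N)
    case 0
    show ?case by (simp add: Y_def s_def)
  next
    case (Suc N)
    note lin = rot_avg_add rot_avg_cmult rot_avg_const
    note IH = Suc[THEN conjunct1] Suc[THEN conjunct2, THEN conjunct1]
      Suc[THEN conjunct2, THEN conjunct2, THEN conjunct1]
      Suc[THEN conjunct2, THEN conjunct2, THEN conjunct2]
    show ?case
      unfolding 1 2 3 4 lin s_Suc IH power_one_right
      by (intro conjI refl third_moment_step fourth_moment_step)
        (simp add: power2_eq_square algebra_simps)
  qed
  then show "rot_avg N (\<lambda>\<epsilon>. Y N \<epsilon>) = s 1 N"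
    and "rot_avg N (\<lambda>\<epsilon>. Y N \<epsilon> ^ 2) = 2 * s 1 N ^ 2 - s 2 N"
    and "rot_avg N (\<lambda>\<epsilon>. Y N \<epsilon> ^ 3) = 6 * s 1 N ^ 3 - 9 * s 1 N * s 2 N + 4 * s 3 N"
    and "rot_avg N (\<lambda>\<epsilon>. Y N \<epsilon> ^ 4) = 24 * s 1 N ^ 4 - 72 * s 1 N ^ 2 * s 2 N
           + 64 * s 1 N * s 3 N + 18 * s 2 N ^ 2 - 33 * s 4 N"
    by blast+
qed

text \<open>
  The bound 15 is the value for the exponential distribution.  The correction
  \<open>- 20 s\<^sub>2 + 20 s\<^sub>3 + 18 s\<^sub>2\<^sup>2 - 33 s\<^sub>4\<close> is not positive: after \<open>s\<^sub>2\<^sup>2 \<le> s\<^sub>3\<close> it is a sum of terms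
  \<open>b\<^sup>2 (- 20 + 38 b - 33 b\<^sup>2)\<close>, and this quadratic has negative discriminant.
\<close>

lemma rot_avg_quartic_le:
  fixes a :: "nat \<Rightarrow> complex" and N :: nat
  defines "Y \<equiv> \<lambda>\<epsilon>. (cmod (\<Sum>l<N. a l * \<epsilon> l))\<^sup>2"
  assumes a: "(\<Sum>l<N. (cmod (a l))\<^sup>2) = 1"
  shows "rot_avg N (\<lambda>\<epsilon>. Y \<epsilon> ^ 4 - 11 * Y \<epsilon> ^ 3 + 47 * Y \<epsilon> ^ 2 - 37 * Y \<epsilon>) \<le> 15"
proof -
  define b where "b l = (cmod (a l))\<^sup>2" for l
  define s where "s k = (\<Sum>l<N. b l ^ k)" for k
  have b: "b l \<ge> 0" for l by (simp add: b_def)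
  have s1: "s 1 = 1" using a by (simp add: s_def b_def)
  have "rot_avg N (\<lambda>\<epsilon>. Y \<epsilon> ^ 4 - 11 * Y \<epsilon> ^ 3 + 47 * Y \<epsilon> ^ 2 - 37 * Y \<epsilon>)
     = 15 - 20 * s 2 + 20 * s 3 + 18 * s 2 ^ 2 - 33 * s 4"
    unfolding rot_avg_add rot_avg_diff rot_avg_cmult Y_def rot_avg_moments
    unfolding b_def[symmetric] s_def[symmetric] s1 by simp
  also have "s 2 ^ 2 \<le> s 3"
  proof -
    have "0 \<le> (\<Sum>l<N. b l * (b l - s 2) ^ 2)" by (intro sum_nonneg mult_nonneg_nonneg b) simp
    also have "\<dots> = (\<Sum>l<N. b l ^ 3 - (2 * s 2) * b l ^ 2 + s 2 ^ 2 * b l ^ 1)"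
      by (intro sum.cong refl) Groebner_Basis.algebra
    also have "\<dots> = s 3 - (2 * s 2) * s 2 + s 2 ^ 2 * s 1"
      by (simp only: s_def sum.distrib sum_subtractf sum_distrib_left)
    finally show ?thesis using s1 by (simp add: power2_eq_square)
  qed
  then have "15 - 20 * s 2 + 20 * s 3 + 18 * s 2 ^ 2 - 33 * s 4 \<le> 15 - (20 * s 2 - 38 * s 3 + 33 * s 4)"
    by simp
  also have "20 * s 2 - 38 * s 3 + 33 * s 4 = (\<Sum>l<N. b l ^ 2 * (33 * (b l - 19/33) ^ 2 + 299/33))"
    unfolding s_def sum_distrib_left sum_subtractf[symmetric] sum.distrib[symmetric]
    by (intro sum.cong refl) (simp add: power2_eq_square power3_eq_cube power4_eq_xxxx algebra_simps)
  also have "15 - \<dots> \<le> 15" by (simp add: sum_nonneg)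
  finally show ?thesis by simp
qed

text \<open>
  The cubic is chosen so that the difference of the two sides has its minima at 1 and 4 and its only
  other critical point at \<open>7/3\<close>.  At 1 both sides vanish; at 4 the claim is \<open>56 ln 2 \<le> 39\<close>.
  The nodes 1 and 4 are rational stand-ins for the Gauss nodes \<open>3 \<plusminus> \<surd>3\<close> of the weight \<open>y exp (- y)\<close>,
  which would minimise the resulting bound.
\<close>

lemma ln_le_cubic:
  assumes "(y::real) > 0"
  shows "28 * ln y \<le> y^3 - 11 * y^2 + 47 * y - 37"
proof -
  define d where "d y = y^3 - 11 * y^2 + 47 * y - 37 - 28 * ln y" for y :: real
  have deriv: "(d has_real_derivative (y - 1) * (y - 4) * (3 * y - 7) / y) (at y)" if "y > 0" for y
    unfolding d_def using that
    by (auto intro!: derivative_eq_intros simp: field_simps power2_eq_square)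
  have d1: "d 1 = 0" by (simp add: d_def)
  have d4: "d 4 \<ge> 0"
  proof -
    have "ln (4::real) = 2 * ln 2" using ln_realpow[of 2 2] by simp
    then show ?thesis using ln2_le_25_over_36 by (simp add: d_def)
  qed
  have up: "d x \<le> d y" if "x \<le> y" "0 < x" "\<And>z. x \<le> z \<Longrightarrow> z \<le> y \<Longrightarrow> (z - 1) * (z - 4) * (3 * z - 7) \<ge> 0" for x y
    using that by (intro DERIV_nonneg_imp_nondecreasing[OF that(1)]) (force intro!: deriv divide_nonneg_pos)
  have down: "d y \<le> d x" if "x \<le> y" "0 < x" "\<And>z. x \<le> z \<Longrightarrow> z \<le> y \<Longrightarrow> (z - 1) * (z - 4) * (3 * z - 7) \<le> 0" for x y
    using that by (intro DERIV_nonpos_imp_nonincreasing[OF that(1)]) (force intro!: deriv divide_nonpos_pos)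
  have "d y \<ge> 0"
  proof -
    consider "y \<le> 1" | "1 \<le> y" "y \<le> 7/3" | "7/3 \<le> y" "y \<le> 4" | "4 \<le> y" by linarith
    then show ?thesis
    proof cases
      case 1
      then have "d 1 \<le> d y" using assms by (intro down) (auto intro!: mult_nonneg_nonpos mult_nonpos_nonpos)
      then show ?thesis by (simp add: d1)
    next
      case 2
      then have "d 1 \<le> d y" by (intro up) (auto intro!: mult_nonpos_nonpos mult_nonneg_nonpos)
      then show ?thesis by (simp add: d1)
    next
      case 3
      have "d 4 \<le> d y"
      proof (rule down)
        fix z assume "y \<le> z" "z \<le> 4"
        with 3 have "(z - 1) * (z - 4) \<le> 0" "3 * z - 7 \<ge> 0" by (auto intro: mult_nonneg_nonpos)
        then show "(z - 1) * (z - 4) * (3 * z - 7) \<le> 0" by (rule mult_nonpos_nonneg)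
      qed (use 3 in auto)
      then show ?thesis using d4 by simp
    next
      case 4
      then have "d 4 \<le> d y" by (intro up) auto
      then show ?thesis using d4 by simp
    qed
  qed
  then show ?thesis by (simp add: d_def)
qed

text \<open>
  Here \<open>y powr (1 - \<delta>) = y exp (- \<delta> ln y)\<close>, and the exponential is bounded below by its tangent at
  \<open>ln y = 15/28\<close>, which \<open>ln_le_cubic\<close> turns into a polynomial.
\<close>

lemma powr_ge_quartic:
  fixes y \<delta> :: real
  assumes "y \<ge> 0" "\<delta> \<ge> 0"
  shows "exp (- \<delta> * (15/28)) * (y + \<delta> * (15/28) * y - \<delta>/28 * (y^4 - 11 * y^3 + 47 * y^2 - 37 * y))
    \<le> y powr (1 - \<delta>)"
proof (cases "y = 0")
  case False
  then have y: "y > 0" using assms by simp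
  have "exp (- \<delta> * (15/28)) * (y + \<delta> * (15/28) * y - \<delta>/28 * (y^4 - 11 * y^3 + 47 * y^2 - 37 * y))
    = (exp (- \<delta> * (15/28)) * y) * (1 + \<delta>/28 * (15 - (y^3 - 11 * y^2 + 47 * y - 37)))"
    by (simp add: algebra_simps power2_eq_square power3_eq_cube power4_eq_xxxx)
  also have "\<dots> \<le> (exp (- \<delta> * (15/28)) * y) * (1 + \<delta>/28 * (15 - 28 * ln y))"
    using assms y ln_le_cubic[OF y] by (intro mult_left_mono add_left_mono diff_left_mono) auto
  also have "\<dots> \<le> (exp (- \<delta> * (15/28)) * y) * exp (\<delta>/28 * (15 - 28 * ln y))"
    using y by (intro mult_left_mono exp_ge_add_one_self) auto
  also have "\<dots> = exp (ln y - \<delta> * ln y)"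
    using y by (simp add: exp_add[symmetric] exp_diff algebra_simps exp_minus field_simps)
  also have "\<dots> = y powr (1 - \<delta>)" using y by (simp add: powr_def algebra_simps)
  finally show ?thesis .
qed simp

text \<open>
  The constant tends to 1 linearly in \<open>\<delta>\<close>, and its slope determines the growth exponent.  After
  normalising the coefficients, take expectations in \<open>powr_ge_quartic\<close>: the terms of order \<open>\<delta>\<close> cancel
  because the quartic has mean at most 15.
\<close>

theorem Khinchine_root5:
  fixes a :: "nat \<Rightarrow> complex"
  assumes \<delta>: "\<delta> \<ge> 0" "\<delta> < 1"
  shows "exp (- \<delta> * (15/28)) * (\<Sum>l<N. (cmod (a l))\<^sup>2) powr (1 - \<delta>)
    \<le> rot_avg N (\<lambda>\<epsilon>. cmod (\<Sum>l<N. a l * \<epsilon> l) powr (2 * (1 - \<delta>)))"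
proof (cases "(\<Sum>l<N. (cmod (a l))\<^sup>2) = 0")
  case True
  have "rot_avg N (\<lambda>\<epsilon>. 0) \<le> rot_avg N (\<lambda>\<epsilon>. cmod (\<Sum>l<N. a l * \<epsilon> l) powr (2 * (1 - \<delta>)))"
    by (intro rot_avg_mono) simp
  then show ?thesis using True by (simp add: rot_avg_const)
next
  case False
  define \<tau> where "\<tau> = (\<Sum>l<N. (cmod (a l))\<^sup>2)"
  have \<tau>: "\<tau> > 0" using False unfolding \<tau>_def by (smt (verit) sum_nonneg zero_le_power2)
  define a' where "a' l = a l / sqrt \<tau>" for l
  define Y where "Y \<epsilon> = (cmod (\<Sum>l<N. a' l * \<epsilon> l))\<^sup>2" for \<epsilon>
  have a': "(\<Sum>l<N. (cmod (a' l))\<^sup>2) = 1"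
    using \<tau> unfolding a'_def by (simp add: norm_divide power_divide sum_divide_distrib[symmetric] \<tau>_def[symmetric])
  have scale: "cmod (\<Sum>l<N. a l * \<epsilon> l) powr (2 * (1 - \<delta>)) = \<tau> powr (1 - \<delta>) * Y \<epsilon> powr (1 - \<delta>)" for \<epsilon>
  proof -
    have "(\<Sum>l<N. a' l * \<epsilon> l) = (\<Sum>l<N. a l * \<epsilon> l) / sqrt \<tau>"
      by (simp add: a'_def sum_divide_distrib)
    then have "(cmod (\<Sum>l<N. a l * \<epsilon> l))\<^sup>2 = \<tau> * Y \<epsilon>"
      using \<tau> by (simp add: Y_def norm_divide power_divide)
    moreover have "cmod (\<Sum>l<N. a l * \<epsilon> l) powr (2 * (1 - \<delta>)) = ((cmod (\<Sum>l<N. a l * \<epsilon> l))\<^sup>2) powr (1 - \<delta>)"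
      by (simp add: powr_powr flip: powr_numeral)
    ultimately show ?thesis using \<tau> by (simp add: powr_mult Y_def)
  qed
  have "exp (- \<delta> * (15/28)) * (1 + \<delta> * (15/28) * 1 - \<delta>/28 * 15)
    \<le> exp (- \<delta> * (15/28)) * (rot_avg N Y + \<delta> * (15/28) * rot_avg N Y
        - \<delta>/28 * rot_avg N (\<lambda>\<epsilon>. Y \<epsilon> ^ 4 - 11 * Y \<epsilon> ^ 3 + 47 * Y \<epsilon> ^ 2 - 37 * Y \<epsilon>))"
  proof -
    have "rot_avg N Y = 1" using rot_avg_moments(1)[of N a'] a' by (simp add: Y_def[abs_def])
    then show ?thesis using rot_avg_quartic_le[OF a'] \<delta> unfolding Y_def
      by (intro mult_left_mono diff_mono) auto
  qed
  also have "\<dots> = rot_avg N (\<lambda>\<epsilon>. exp (- \<delta> * (15/28)) * (Y \<epsilon> + \<delta> * (15/28) * Y \<epsilon>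
        - \<delta>/28 * (Y \<epsilon> ^ 4 - 11 * Y \<epsilon> ^ 3 + 47 * Y \<epsilon> ^ 2 - 37 * Y \<epsilon>)))"
    by (simp only: rot_avg_add rot_avg_diff rot_avg_cmult)
  also have "\<dots> \<le> rot_avg N (\<lambda>\<epsilon>. Y \<epsilon> powr (1 - \<delta>))"
    using \<delta> by (intro rot_avg_mono powr_ge_quartic) (auto simp: Y_def)
  finally have "exp (- \<delta> * (15/28)) \<le> rot_avg N (\<lambda>\<epsilon>. Y \<epsilon> powr (1 - \<delta>))" by simp
  then have "\<tau> powr (1 - \<delta>) * exp (- \<delta> * (15/28)) \<le> \<tau> powr (1 - \<delta>) * rot_avg N (\<lambda>\<epsilon>. Y \<epsilon> powr (1 - \<delta>))"
    by (intro mult_left_mono) auto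
  then show ?thesis unfolding scale rot_avg_cmult \<tau>_def[symmetric] by (simp add: mult.commute)
qed

section \<open>Multilinear forms on the polydisc\<close>

lemma multilinear_form_expand:
  assumes U: "multilinear_form n N U" and k: "k < n" and z: "z \<in> {..<n} \<rightarrow>\<^sub>E carrier_vec N"
    and v: "v \<in> carrier_vec N"
  shows "U (z(k := v)) = (\<Sum>l<N. vec_index v l * U (z(k := unit_vec N l)))"
proof -
  have add: "U (z(k := x + y)) = U (z(k := x)) + U (z(k := y))"
    if "x \<in> carrier_vec N" "y \<in> carrier_vec N" for x y
    using U k z that unfolding multilinear_form_def by blast
  have smult: "U (z(k := a \<cdot>\<^sub>v x)) = a * U (z(k := x))" if "x \<in> carrier_vec N" for a x
    using U k z that unfolding multilinear_form_def by blast
  define w where "w j = Matrix.vec N (\<lambda>i. if i < j then vec_index v i else 0)" for j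
  have w: "w j \<in> carrier_vec N" for j by (simp add: w_def)
  have "U (z(k := w j)) = (\<Sum>l<j. vec_index v l * U (z(k := unit_vec N l)))" if "j \<le> N" for j
    using that
  proof (induction j)
    case 0
    have "w 0 = 0 \<cdot>\<^sub>v w 0" by (intro eq_vecI) (auto simp: w_def)
    then have "U (z(k := w 0)) = 0" using smult[OF w, of 0 0] by simp
    then show ?case by (simp only: lessThan_0 sum.empty)
  next
    case (Suc j)
    have w_Suc: "w (Suc j) = w j + vec_index v j \<cdot>\<^sub>v unit_vec N j"
      using Suc.prems by (intro eq_vecI) (auto simp: w_def unit_vec_def less_Suc_eq)
    have "U (z(k := w (Suc j))) = U (z(k := w j)) + U (z(k := vec_index v j \<cdot>\<^sub>v unit_vec N j))"
      unfolding w_Suc by (rule add[OF w]) simp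
    also have "U (z(k := vec_index v j \<cdot>\<^sub>v unit_vec N j)) = vec_index v j * U (z(k := unit_vec N j))"
      by (rule smult) simp
    also have "U (z(k := w j)) = (\<Sum>l<j. vec_index v l * U (z(k := unit_vec N l)))"
      using Suc by linarith
    finally show ?case by (simp only: sum.lessThan_Suc)
  qed
  moreover have "w N = v" using v by (intro eq_vecI) (auto simp: w_def)
  ultimately show ?thesis by (metis order_refl)
qed

lemma unit_polydisc_carrier: "unit_polydisc N \<subseteq> carrier_vec N"
  by (auto simp: unit_polydisc_def)

text \<open>
  Replacing the slots one after the other by combinations of unit vectors reduces the bound to the
  finitely many values at tuples of unit vectors.
\<close>

lemma multilinear_form_bounded:
  assumes U: "multilinear_form n N U"
  shows "bdd_above ((\<lambda>z. cmod (U z)) ` ({..<n} \<rightarrow>\<^sub>E unit_polydisc N))"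
proof -
  define E where "E r k = (if k < r then unit_polydisc N else unit_vec N ` {..<N})" for r k :: nat
  have E: "E r k \<subseteq> carrier_vec N" for r k using unit_polydisc_carrier by (auto simp: E_def)
  have "\<exists>B. \<forall>z\<in>PiE {..<n} (E r). cmod (U z) \<le> B" if "r \<le> n" for r
    using that
  proof (induction r)
    case 0
    have "finite (PiE {..<n} (E 0))" by (intro finite_PiE) (auto simp: E_def)
    then have "bdd_above ((\<lambda>z. cmod (U z)) ` PiE {..<n} (E 0))" by (intro bdd_above_finite finite_imageI)
    then show ?case by (auto simp: bdd_above_def)
  next
    case (Suc r)
    then obtain B where B: "\<And>z. z \<in> PiE {..<n} (E r) \<Longrightarrow> cmod (U z) \<le> B" by auto
    have "cmod (U z) \<le> real N * B" if z: "z \<in> PiE {..<n} (E (Suc r))" for z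
    proof -
      have r: "r < n" using Suc.prems by simp
      have zr: "z r \<in> unit_polydisc N" using PiE_mem[OF z, of r] r by (simp add: E_def)
      have zc: "z \<in> {..<n} \<rightarrow>\<^sub>E carrier_vec N" by (rule subsetD[OF PiE_mono[OF E] z])
      have "cmod (U (z(r := unit_vec N l))) \<le> B" if "l < N" for l
      proof (rule B)
        show "z(r := unit_vec N l) \<in> PiE {..<n} (E r)"
          using z r that by (auto simp: PiE_iff E_def extensional_def less_Suc_eq split: if_splits)
      qed
      then have "cmod (vec_index (z r) l * U (z(r := unit_vec N l))) \<le> B" if "l < N" for l
        using zr that mult_left_le_one_le[of "cmod (U (z(r := unit_vec N l)))" "cmod (vec_index (z r) l)"]
        by (force simp: norm_mult unit_polydisc_def)
      then have "cmod (\<Sum>l<N. vec_index (z r) l * U (z(r := unit_vec N l))) \<le> (\<Sum>l<N. B)"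
        by (intro sum_norm_le) auto
      also have "(\<Sum>l<N. vec_index (z r) l * U (z(r := unit_vec N l))) = U (z(r := z r))"
        using zr unit_polydisc_carrier by (intro multilinear_form_expand[OF U r zc, symmetric]) auto
      finally show ?thesis by simp
    qed
    then show ?case by blast
  qed
  from this[of n] obtain B where "\<forall>z\<in>PiE {..<n} (E n). cmod (U z) \<le> B" by auto
  moreover have "PiE {..<n} (E n) = {..<n} \<rightarrow>\<^sub>E unit_polydisc N" by (intro PiE_cong) (simp add: E_def)
  ultimately show ?thesis by (auto simp: bdd_above_def)
qed

abbreviation polydisc_norm :: "nat \<Rightarrow> nat \<Rightarrow> ((nat \<Rightarrow> complex Matrix.vec) \<Rightarrow> complex) \<Rightarrow> real" where
  "polydisc_norm n N U \<equiv> (SUP z \<in> {..<n} \<rightarrow>\<^sub>E unit_polydisc N. cmod (U z))"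

lemma zero_in_polydisc: "(\<lambda>k\<in>{..<n}. 0\<^sub>v N) \<in> {..<n} \<rightarrow>\<^sub>E unit_polydisc N"
  by (auto simp: unit_polydisc_def)

lemma cmod_le_polydisc_norm:
  assumes "multilinear_form n N U" "z \<in> {..<n} \<rightarrow>\<^sub>E unit_polydisc N"
  shows "cmod (U z) \<le> polydisc_norm n N U"
  using assms by (intro cSUP_upper multilinear_form_bounded)

lemma polydisc_norm_nonneg: "multilinear_form n N U \<Longrightarrow> polydisc_norm n N U \<ge> 0"
  using cmod_le_polydisc_norm[OF _ zero_in_polydisc, of n N U] norm_ge_zero order_trans by blast

text \<open>
  Unimodular vectors lie only in the closed polydisc; scaling the slot by \<open>\<rho> < 1\<close> and letting \<open>\<rho>\<close> tend
  to 1 brings them under the supremum over the open one.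
\<close>

lemma cmod_closed_slot_le:
  assumes U: "multilinear_form n N U" and k: "k < n" and z: "z \<in> {..<n} \<rightarrow>\<^sub>E unit_polydisc N"
    and v: "v \<in> carrier_vec N" "\<And>i. i < N \<Longrightarrow> cmod (vec_index v i) \<le> 1"
  shows "cmod (U (z(k := v))) \<le> polydisc_norm n N U"
proof (rule field_le_mult_one_interval)
  fix \<rho> :: real assume \<rho>: "0 < \<rho>" "\<rho> < 1"
  have zc: "z \<in> {..<n} \<rightarrow>\<^sub>E carrier_vec N" by (rule subsetD[OF PiE_mono[OF unit_polydisc_carrier] z])
  have "U (z(k := complex_of_real \<rho> \<cdot>\<^sub>v v)) = complex_of_real \<rho> * U (z(k := v))"
    using U k zc v unfolding multilinear_form_def by blast
  then have "\<rho> * cmod (U (z(k := v))) = cmod (U (z(k := complex_of_real \<rho> \<cdot>\<^sub>v v)))"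
    using \<rho> by (simp add: norm_mult)
  also have "\<dots> \<le> polydisc_norm n N U"
  proof (rule cmod_le_polydisc_norm[OF U])
    have "\<rho> * cmod (vec_index v i) < 1" if "i < N" for i
      using \<rho> mult_left_mono[OF v(2)[OF that] less_imp_le[OF \<rho>(1)]] by linarith
    then have "complex_of_real \<rho> \<cdot>\<^sub>v v \<in> unit_polydisc N"
      using v(1) \<rho> by (auto simp: unit_polydisc_def norm_mult)
    then show "z(k := complex_of_real \<rho> \<cdot>\<^sub>v v) \<in> {..<n} \<rightarrow>\<^sub>E unit_polydisc N"
      using z k by (auto simp: PiE_iff extensional_def)
  qed
  finally show "\<rho> * cmod (U (z(k := v))) \<le> polydisc_norm n N U" .
qed

section \<open>The Bohnenblust--Hille inequality by induction on the degree\<close>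

text \<open>
  The increasing enumeration of the natural numbers other than \<open>j\<close>.
\<close>

definition skip :: "nat \<Rightarrow> nat \<Rightarrow> nat" where
  "skip j k = (if k < j then k else Suc k)"

definition insert_slot :: "nat \<Rightarrow> nat \<Rightarrow> 'v \<Rightarrow> (nat \<Rightarrow> 'v) \<Rightarrow> nat \<Rightarrow> 'v" where
  "insert_slot n j v w =
    (\<lambda>k\<in>{..<Suc n}. if k = j then v else w (if k < j then k else k - 1))"

lemma bij_betw_skip: "j \<le> n \<Longrightarrow> bij_betw (skip j) {..<n} ({..<Suc n} - {j})"
  by (rule bij_betw_byWitness[where f' = "\<lambda>k. if k < j then k else k - 1"]) (auto simp: skip_def)

lemma insert_slot_upd_outer: "j \<le> n \<Longrightarrow> insert_slot n j v w = (insert_slot n j u w)(j := v)"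
  by (auto simp: insert_slot_def)

lemma insert_slot_upd_inner:
  "k < n \<Longrightarrow> insert_slot n j v (w(k := x)) = (insert_slot n j v w)(skip j k := x)"
  by (auto simp: insert_slot_def skip_def fun_eq_iff)

lemma insert_slot_PiE:
  assumes "j \<le> n" "v \<in> T" "w \<in> {..<n} \<rightarrow>\<^sub>E T"
  shows "insert_slot n j v w \<in> {..<Suc n} \<rightarrow>\<^sub>E T"
  using assms by (auto simp: insert_slot_def PiE_iff)

lemma multilinear_form_insert_slot:
  assumes U: "multilinear_form (Suc n) N U" and j: "j \<le> n" and v: "v \<in> carrier_vec N"
  shows "multilinear_form n N (\<lambda>w. U (insert_slot n j v w))"
  unfolding multilinear_form_def
proof (intro allI impI ballI, goal_cases)
  case (1 k w)
  have "skip j k < Suc n" using 1 by (auto simp: skip_def)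
  moreover have "insert_slot n j v w \<in> {..<Suc n} \<rightarrow>\<^sub>E carrier_vec N"
    using j v 1 by (intro insert_slot_PiE) auto
  ultimately show ?case using U 1 unfolding multilinear_form_def by (auto simp: insert_slot_upd_inner)
qed

lemma polydisc_norm_insert_slot_le:
  assumes U: "multilinear_form (Suc n) N U" and j: "j \<le> n"
    and v: "v \<in> carrier_vec N" "\<And>i. i < N \<Longrightarrow> cmod (vec_index v i) \<le> 1"
  shows "polydisc_norm n N (\<lambda>w. U (insert_slot n j v w)) \<le> polydisc_norm (Suc n) N U"
proof (rule cSUP_least)
  show "{..<n} \<rightarrow>\<^sub>E unit_polydisc N \<noteq> {}" using zero_in_polydisc[of N n] by (metis empty_iff)
  fix w assume w: "w \<in> {..<n} \<rightarrow>\<^sub>E unit_polydisc N"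
  have "0\<^sub>v N \<in> unit_polydisc N" by (simp add: unit_polydisc_def)
  then have z: "insert_slot n j (0\<^sub>v N) w \<in> {..<Suc n} \<rightarrow>\<^sub>E unit_polydisc N"
    using j w by (intro insert_slot_PiE)
  show "cmod (U (insert_slot n j v w)) \<le> polydisc_norm (Suc n) N U"
    using cmod_closed_slot_le[OF U _ z v, of j] j by (simp add: insert_slot_upd_outer[OF j, of v w "0\<^sub>v N"])
qed

lemma sum_PiE_reindex:
  assumes "bij_betw h A B"
  shows "(\<Sum>x\<in>B \<rightarrow>\<^sub>E T. g (\<lambda>k\<in>A. x (h k))) = (\<Sum>i\<in>A \<rightarrow>\<^sub>E T. g i)"
proof (rule sum.reindex_bij_witness[where i = "\<lambda>i. \<lambda>k\<in>B. i (the_inv_into A h k)" and j = "\<lambda>x. \<lambda>k\<in>A. x (h k)"])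
  have inj: "inj_on h A" and hA: "h ` A = B" using assms by (auto simp: bij_betw_def)
  have inv: "the_inv_into A h k \<in> A" "h (the_inv_into A h k) = k" if "k \<in> B" for k
    using that inj hA by (auto intro: the_inv_into_into f_the_inv_into_f)
  fix x assume x: "x \<in> B \<rightarrow>\<^sub>E T"
  show "(\<lambda>k\<in>B. (\<lambda>k\<in>A. x (h k)) (the_inv_into A h k)) = x"
    using x inv by (auto simp: fun_eq_iff PiE_iff extensional_def)
  show "(\<lambda>k\<in>A. x (h k)) \<in> A \<rightarrow>\<^sub>E T" using x hA by auto
next
  have inj: "inj_on h A" and hA: "h ` A = B" using assms by (auto simp: bij_betw_def)
  fix i assume i: "i \<in> A \<rightarrow>\<^sub>E T"
  show "(\<lambda>k\<in>A. (\<lambda>k\<in>B. i (the_inv_into A h k)) (h k)) = i"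
    using i inj hA by (auto simp: fun_eq_iff PiE_iff extensional_def the_inv_into_f_f)
  show "(\<lambda>k\<in>B. i (the_inv_into A h k)) \<in> B \<rightarrow>\<^sub>E T"
    using i inj hA by (auto simp: the_inv_into_f_f)
qed simp

text \<open>
  For a linear form, evaluate at the vector of conjugate phases of the coefficients.
\<close>

lemma BH_inequality_1: "BH_inequality 1 1"
  unfolding BH_inequality_def
proof (intro allI impI)
  fix N :: nat and U assume U: "multilinear_form 1 N U"
  define z where "z = (\<lambda>k\<in>{..<1::nat}. 0\<^sub>v N :: complex Matrix.vec)"
  have z: "z \<in> {..<1} \<rightarrow>\<^sub>E unit_polydisc N" unfolding z_def by (rule zero_in_polydisc)
  then have zc: "z \<in> {..<1} \<rightarrow>\<^sub>E carrier_vec N" by (rule subsetD[OF PiE_mono[OF unit_polydisc_carrier]])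
  define a where "a l = U (z(0 := unit_vec N l))" for l
  define v where "v = Matrix.vec N (\<lambda>l. cnj (sgn (a l)))"
  have v: "v \<in> carrier_vec N" "\<And>i. i < N \<Longrightarrow> cmod (vec_index v i) \<le> 1"
    by (auto simp: v_def norm_sgn)
  have "U (z(0 := v)) = (\<Sum>l<N. vec_index v l * a l)"
    unfolding a_def by (rule multilinear_form_expand[OF U _ zc v(1)]) simp
  also have "\<dots> = (\<Sum>l<N. complex_of_real (cmod (a l)))"
    by (intro sum.cong) (auto simp: v_def sgn_div_norm complex_norm_square[symmetric] power2_eq_square
        scaleR_conv_of_real field_simps)
  finally have "cmod (U (z(0 := v))) = (\<Sum>l<N. cmod (a l))"
    by (simp add: sum_nonneg flip: of_real_sum)
  moreover have "(\<Sum>i \<in> {..<1} \<rightarrow>\<^sub>E {..<N}. cmod (U (\<lambda>k\<in>{..<1}. unit_vec N (i k)))) = (\<Sum>l<N. cmod (a l))"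
  proof -
    have "(\<lambda>k\<in>{..<1::nat}. unit_vec N (((\<lambda>_. undefined)(0 := l)) k)) = z(0 := unit_vec N l)" for l
      by (auto simp: z_def fun_eq_iff)
    then show ?thesis
      using sum_PiE_insert[of "0::nat" "{}" "\<lambda>i. cmod (U (\<lambda>k\<in>{..<1}. unit_vec N (i k)))" "{..<N}"]
      by (simp add: a_def lessThan_Suc)
  qed
  ultimately show "(\<Sum>i \<in> {..<1} \<rightarrow>\<^sub>E {..<N}. cmod (U (\<lambda>k\<in>{..<1}. unit_vec N (i k)))
      powr (2 * real 1 / (real 1 + 1))) powr ((real 1 + 1) / (2 * real 1)) \<le> 1 * polydisc_norm 1 N U"
    using cmod_closed_slot_le[OF U _ z v, of 0] by (simp add: sum_nonneg)
qed

text \<open>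
  By Blei's inequality it suffices to bound, for every slot \<open>j\<close>, the mixed norm with the 2-norm taken
  over the index of slot \<open>j\<close>.  The Khinchine inequality with \<open>\<delta> = 1 / (n + 1)\<close> replaces that 2-norm by
  the average of the values of \<open>U\<close> with a random unimodular vector in slot \<open>j\<close>.  For each such vector,
  \<open>U\<close> becomes an \<open>n\<close>-linear form to which the inequality of degree \<open>n\<close>, whose exponent is exactly
  \<open>p = 2 (1 - \<delta>)\<close>, applies.  The loss is \<open>exp (15/28 * \<delta> / p) = exp (15/56 / n)\<close>.
\<close>

lemma BH_inequality_Suc:
  assumes n: "n \<ge> 1" and C: "C \<ge> 1" and BH: "BH_inequality n C"
  shows "BH_inequality (Suc n) (exp (15/56 / real n) * C)"
  unfolding BH_inequality_def
proof (intro allI impI)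
  fix N :: nat and U assume N: "N \<ge> 1" and U: "multilinear_form (Suc n) N U"
  define p where "p = 2 * real n / (real n + 1)"
  define q where "q = 2 * real (Suc n) / (real (Suc n) + 1)"
  define \<delta> where "\<delta> = 1 / (real n + 1)"
  define S where "S = polydisc_norm (Suc n) N U"
  define e where "e x = (\<lambda>k\<in>{..<Suc n}. unit_vec N (x k) :: complex Matrix.vec)" for x :: "nat \<Rightarrow> nat"
  define f where "f x = cmod (U (e x))" for x
  define M where "M = exp (15/56 / real n) * C * S"
  have S: "S \<ge> 0" unfolding S_def by (rule polydisc_norm_nonneg[OF U])
  have p: "p > 0" "p = 2 * (1 - \<delta>)" and \<delta>: "\<delta> \<ge> 0" "\<delta> < 1"
    using n by (auto simp: p_def \<delta>_def field_simps)
  have M: "M \<ge> 0" using S C by (simp add: M_def)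
  have Mp: "M powr p = exp (\<delta> * (15/28)) * (C * S) powr p"
  proof -
    have "exp (15/56 / real n) powr p = exp (\<delta> * (15/28))"
    proof -
      have "15/56 / real n * p = \<delta> * (15/28)" using n by (simp add: p_def \<delta>_def)
      then show ?thesis by (simp only: exp_powr_real)
    qed
    then show ?thesis using S C by (simp add: M_def powr_mult mult.assoc)
  qed
  have slot: "(\<Sum>x\<in>({..<Suc n} - {j}) \<rightarrow>\<^sub>E {..<N}. (\<Sum>l<N. (f (x(j := l)))\<^sup>2) powr (p / 2)) \<le> M powr p"
    if "j \<in> {..<Suc n}" for j
  proof -
    have j: "j \<le> n" using that by simp
    define X where "X = ({..<Suc n} - {j}) \<rightarrow>\<^sub>E {..<N}"
    have fX: "finite X" unfolding X_def by (intro finite_PiE) auto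
    define g where "g \<epsilon> x = cmod (\<Sum>l<N. U (e (x(j := l))) * \<epsilon> l) powr p" for \<epsilon> :: "nat \<Rightarrow> complex" and x
    have khinchine: "exp (- \<delta> * (15/28)) * (\<Sum>l<N. (f (x(j := l)))\<^sup>2) powr (p / 2) \<le> rot_avg N (\<lambda>\<epsilon>. g \<epsilon> x)" for x
    proof -
      have half: "p / 2 = 1 - \<delta>" using p(2) by simp
      show ?thesis
        unfolding g_def f_def half unfolding p(2) using Khinchine_root5[OF \<delta>, of "\<lambda>l. U (e (x(j := l)))" N] by simp
    qed
    have bound: "(\<Sum>x\<in>X. g \<epsilon> x) \<le> (C * S) powr p" if \<epsilon>: "\<forall>l. cmod (\<epsilon> l) = 1" for \<epsilon>
    proof -
      define v where "v = Matrix.vec N \<epsilon>"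
      have v: "v \<in> carrier_vec N" "\<And>i. i < N \<Longrightarrow> cmod (vec_index v i) \<le> 1"
        using \<epsilon> by (auto simp: v_def)
      define V where "V w = U (insert_slot n j v w)" for w
      have V: "multilinear_form n N V" unfolding V_def by (rule multilinear_form_insert_slot[OF U j v(1)])
      have "polydisc_norm n N V \<le> S"
        unfolding V_def S_def by (rule polydisc_norm_insert_slot_le[OF U j v])
      then have CS: "C * polydisc_norm n N V \<le> C * S" using C by simp
      have gV: "g \<epsilon> x = cmod (V (\<lambda>k\<in>{..<n}. unit_vec N ((\<lambda>k\<in>{..<n}. x (skip j k)) k))) powr p" if x: "x \<in> X" for x
      proof -
        have el: "e (x(j := l)) = (e x)(j := unit_vec N l)" for l
          using j by (auto simp: e_def fun_eq_iff)
        have "e x \<in> {..<Suc n} \<rightarrow>\<^sub>E carrier_vec N" by (auto simp: e_def)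
        then have "U ((e x)(j := v)) = (\<Sum>l<N. vec_index v l * U ((e x)(j := unit_vec N l)))"
          using j v by (intro multilinear_form_expand[OF U]) auto
        also have "\<dots> = (\<Sum>l<N. U (e (x(j := l))) * \<epsilon> l)"
          unfolding el by (intro sum.cong) (auto simp: v_def)
        also have "(e x)(j := v) = insert_slot n j v (\<lambda>k\<in>{..<n}. unit_vec N ((\<lambda>k\<in>{..<n}. x (skip j k)) k))"
          using j by (auto simp: e_def insert_slot_def skip_def fun_eq_iff)
        finally show ?thesis by (simp only: g_def V_def)
      qed
      have "(\<Sum>x\<in>X. g \<epsilon> x) = (\<Sum>i\<in>{..<n} \<rightarrow>\<^sub>E {..<N}. cmod (V (\<lambda>k\<in>{..<n}. unit_vec N (i k))) powr p)"
        unfolding sum_PiE_reindex[OF bij_betw_skip[OF j], symmetric] X_def[symmetric]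
        by (intro sum.cong refl gV)
      also have "\<dots> = (\<dots> powr ((real n + 1) / (2 * real n))) powr p"
        using n by (simp add: powr_powr p_def sum_nonneg)
      also have "\<dots> \<le> (C * S) powr p"
        using BH N V CS p unfolding BH_inequality_def p_def by (intro powr_mono2) (auto intro: order_trans)
      finally show ?thesis .
    qed
    have "exp (- \<delta> * (15/28)) * (\<Sum>x\<in>X. (\<Sum>l<N. (f (x(j := l)))\<^sup>2) powr (p / 2))
       \<le> (\<Sum>x\<in>X. rot_avg N (\<lambda>\<epsilon>. g \<epsilon> x))"
      unfolding sum_distrib_left by (intro sum_mono khinchine)
    also have "\<dots> = rot_avg N (\<lambda>\<epsilon>. \<Sum>x\<in>X. g \<epsilon> x)" using fX by (simp add: rot_avg_sum)
    also have "\<dots> \<le> rot_avg N (\<lambda>\<epsilon>. (C * S) powr p)" by (intro rot_avg_mono bound)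
    also have "\<dots> = (C * S) powr p" by (rule rot_avg_const)
    finally have "exp (\<delta> * (15/28)) * (exp (- \<delta> * (15/28)) * (\<Sum>x\<in>X. (\<Sum>l<N. (f (x(j := l)))\<^sup>2) powr (p / 2)))
       \<le> exp (\<delta> * (15/28)) * (C * S) powr p" by (intro mult_left_mono) auto
    then show ?thesis unfolding Mp X_def by (simp add: mult.assoc[symmetric] exp_minus)
  qed
  have "(\<Sum>x\<in>{..<Suc n} \<rightarrow>\<^sub>E {..<N}. f x powr q) powr (1 / q) \<le> M"
    by (rule Blei_inequality[OF _ _ _ n _ M p_def q_def slot]) (auto simp: f_def)
  then show "(\<Sum>i \<in> {..<Suc n} \<rightarrow>\<^sub>E {..<N}. cmod (U (\<lambda>k\<in>{..<Suc n}. unit_vec N (i k)))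
      powr (2 * real (Suc n) / (real (Suc n) + 1))) powr ((real (Suc n) + 1) / (2 * real (Suc n)))
      \<le> exp (15/56 / real n) * C * polydisc_norm (Suc n) N U"
    by (simp add: f_def e_def q_def M_def S_def)
qed

lemma BH_inequality_harm: "BH_inequality (Suc n) (exp (15/56 * harm n))"
proof (induction n)
  case 0
  show ?case using BH_inequality_1 by (simp add: harm_def)
next
  case (Suc n)
  have "exp (15/56 * harm n) \<ge> (1::real)" by (simp add: harm_nonneg)
  from BH_inequality_Suc[OF _ this Suc]
  have "BH_inequality (Suc (Suc n)) (exp (15/56 / real (Suc n)) * exp (15/56 * harm n))" by simp
  also have "exp (15/56 / real (Suc n)) * exp (15/56 * harm n) = exp (15/56 * harm (Suc n) :: real)"
    unfolding exp_add[symmetric] harm_Suc by (simp add: distrib_left inverse_eq_divide add.commute)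
  finally show ?case .
qed

text \<open>
  The admissible constants form a closed half-line, so the least one is their infimum.
\<close>

lemma BH_constant_bounds:
  assumes "1 \<le> C" "BH_inequality n C"
  shows "1 \<le> BH_constant n" "BH_constant n \<le> C"
proof -
  define A where "A = {C. 1 \<le> C \<and> BH_inequality n C}"
  have C: "C \<in> A" using assms by (simp add: A_def)
  have bdd: "bdd_below A" by (rule bdd_belowI[of _ 1]) (simp add: A_def)
  have ge1: "1 \<le> Inf A" using C by (intro cInf_greatest) (auto simp: A_def)
  have "BH_inequality n (Inf A)"
    unfolding BH_inequality_def
  proof (intro allI impI)
    fix N :: nat and U assume N: "N \<ge> 1" and U: "multilinear_form n N U"
    let ?l = "(\<Sum>i \<in> {..<n} \<rightarrow>\<^sub>E {..<N}. cmod (U (\<lambda>k\<in>{..<n}. unit_vec N (i k)))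
      powr (2 * real n / (real n + 1))) powr ((real n + 1) / (2 * real n))"
    let ?S = "polydisc_norm n N U"
    have le: "?l \<le> D * ?S" if "D \<in> A" for D using that N U unfolding A_def BH_inequality_def by blast
    show "?l \<le> Inf A * ?S"
    proof (cases "?S = 0")
      case True
      then show ?thesis using le[OF C] by simp
    next
      case False
      then have S: "?S > 0" using polydisc_norm_nonneg[OF U] by linarith
      have "?l / ?S \<le> Inf A"
        using C le S by (intro cInf_greatest) (auto simp: divide_le_eq)
      then show ?thesis using S by (simp add: divide_le_eq)
    qed
  qed
  then have "BH_constant n = Inf A"
    unfolding BH_constant_def using ge1 bdd
    by (intro Least_equality) (auto simp: A_def intro: cInf_lower)
  then show "1 \<le> BH_constant n" "BH_constant n \<le> C" using ge1 cInf_lower[OF C bdd] by auto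
qed

lemma BH_constant_growth:
  assumes "n \<ge> 1"
  shows "1 \<le> BH_constant n" "BH_constant n \<le> exp (15/56) * real n powr (15/56)"
proof -
  have ge1: "exp (15/56 * harm (n - 1)) \<ge> (1::real)" by (simp add: harm_nonneg)
  have BH: "BH_inequality n (exp (15/56 * harm (n - 1)))" using BH_inequality_harm[of "n - 1"] assms by simp
  show "1 \<le> BH_constant n" by (rule BH_constant_bounds(1)[OF ge1 BH])
  have "harm (n - 1) \<le> (harm n :: real)" by (intro harm_mono) simp
  also have "harm n - ln (real n) \<le> harm 1 - ln (real 1)"
    using assms by (intro euler_mascheroni_sequence_decreasing) auto
  then have "harm n \<le> 1 + ln (real n)" by (simp add: harm_def)
  finally have "exp (15/56 * harm (n - 1)) \<le> exp (15/56 * (1 + ln (real n)))" by simp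
  also have "\<dots> = exp (15/56) * real n powr (15/56)"
    using assms by (simp add: powr_def exp_add[symmetric] algebra_simps)
  finally show "BH_constant n \<le> exp (15/56) * real n powr (15/56)"
    using BH_constant_bounds(2)[OF ge1 BH] by linarith
qed

section \<open>Increments of slowly growing sequences\<close>

text \<open>
  Otherwise all increments from some \<open>m\<close> on are large, and summing them over \<open>[m, 2m)\<close> makes
  \<open>K (2 m)\<close> at least a constant times \<open>m powr min q 1\<close>, against the growth bound.
\<close>

lemma infinitely_many_small_increments:
  fixes K :: "nat \<Rightarrow> real"
  assumes nonneg: "\<And>n. n \<ge> 1 \<Longrightarrow> 0 \<le> K n" and growth: "\<And>n. n \<ge> 1 \<Longrightarrow> K n \<le> B * real n powr c"
    and c: "c < 1" "c < q" and d: "d > 0"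
  shows "infinite {n. n \<ge> 1 \<and> K (n + 1) - K n < d * real n powr (q - 1)}"
proof
  assume "finite {n. n \<ge> 1 \<and> K (n + 1) - K n < d * real n powr (q - 1)}"
  then obtain n0 where n0: "\<And>n. n \<in> {n. n \<ge> 1 \<and> K (n + 1) - K n < d * real n powr (q - 1)} \<Longrightarrow> n < n0"
    using finite_nat_set_iff_bounded by auto
  \<comment> \<open>with an exponent at most 1 the lower bounds for the increments decrease\<close>
  define r where "r = min q 1"
  have r: "c < r" "r \<le> 1" "r \<le> q" using c by (auto simp: r_def)
  have step: "K (n + 1) - K n \<ge> d * real n powr (r - 1)" if "n \<ge> max 1 n0" for n
  proof -
    have "d * real n powr (r - 1) \<le> d * real n powr (q - 1)"
      using that d r by (intro mult_left_mono powr_mono) auto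
    then show ?thesis using n0[of n] that by force
  qed
  obtain m where m: "m \<ge> max 1 n0" "real m > (\<bar>2 * B / d\<bar>) powr (1 / (r - c))"
    using reals_Archimedean2[of "max (real (max 1 n0)) (\<bar>2 * B / d\<bar> powr (1 / (r - c)))"]
    by (metis less_imp_le max_less_iff_conj of_nat_le_iff)
  have "K (m + k) \<ge> real k * (d * real (2 * m) powr (r - 1))" if "k \<le> m" for k
    using that
  proof (induction k)
    case 0
    show ?case using nonneg m by simp
  next
    case (Suc k)
    have "d * real (2 * m) powr (r - 1) \<le> d * real (m + k) powr (r - 1)"
      using Suc.prems m r d by (intro mult_left_mono powr_mono2') auto
    also have "\<dots> \<le> K (m + k + 1) - K (m + k)" using m by (intro step) simp
    finally show ?case using Suc by (simp add: algebra_simps)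
  qed
  from this[of m] have "real m * (d * real (2 * m) powr (r - 1)) \<le> K (2 * m)" by (simp flip: mult_2)
  also have "\<dots> \<le> B * real (2 * m) powr c" using m by (intro growth) auto
  finally have "real (2 * m) * (d * real (2 * m) powr (r - 1)) \<le> 2 * B * real (2 * m) powr c" by simp
  moreover have "real (2 * m) powr (r - c) * real (2 * m) powr c = real (2 * m) * real (2 * m) powr (r - 1)"
    using m by (simp add: powr_add[symmetric] powr_mult_base)
  ultimately have "d * real (2 * m) powr (r - c) * real (2 * m) powr c \<le> 2 * B * real (2 * m) powr c"
    by (simp add: mult_ac)
  then have "d * real (2 * m) powr (r - c) \<le> 2 * B" using m by simp
  then have "real (2 * m) powr (r - c) \<le> \<bar>2 * B / d\<bar>" using d by (simp add: field_simps)
  also have "\<dots> = (\<bar>2 * B / d\<bar> powr (1 / (r - c))) powr (r - c)" using r by (simp add: powr_powr)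
  also have "\<dots> < real m powr (r - c)" using m r by (intro powr_less_mono2) auto
  also have "\<dots> \<le> real (2 * m) powr (r - c)" using r by (intro powr_mono2) auto
  finally show False by simp
qed

theorem mainTheorem5:
  "(\<forall>\<epsilon>::real. \<epsilon> > 0 \<longrightarrow>
      infinite {n::nat. n \<ge> 1 \<and>
        BH_constant (n + 1) - BH_constant n
          < (4 / sqrt pi - 4 / (exp (1/2 - 1/2 * euler_mascheroni) * sqrt pi))
            * real n powr (log 2 (exp (1/2 - 1/2 * euler_mascheroni) / 2) + \<epsilon>)}) \<and>
   infinite {n::nat. n \<ge> 1 \<and>
     BH_constant (n + 1) - BH_constant n < 0.44 / real n powr 0.695025}"
proof (intro conjI allI impI)
  define t :: real where "t = 1/2 - 1/2 * euler_mascheroni"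
  \<comment> \<open>this makes the exponent \<open>t / ln 2\<close> larger than \<open>15/56\<close>\<close>
  have t: "t > 9/44" using euler_mascheroni_less_13_over_22 by (simp add: t_def)
  have small: "infinite {n. n \<ge> 1 \<and> BH_constant (n + 1) - BH_constant n < d * real n powr (q - 1)}"
    if "15/56 < q" "d > 0" for q d
    using that BH_constant_growth
    by (intro infinitely_many_small_increments[where c = "15/56" and B = "exp (15/56)"]) (auto intro: order_trans[of 0 1])
  {
    fix \<epsilon> :: real assume \<epsilon>: "\<epsilon> > 0"
    have "15/56 * ln 2 \<le> 15/56 * (25/36 :: real)" using ln2_le_25_over_36 by simp
    also have "\<dots> < t" using t by simp
    finally have "15/56 < t / ln 2" by (simp add: pos_less_divide_eq)
    then have "15/56 < t / ln 2 + \<epsilon>" using \<epsilon> by linarith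
    moreover have "4 / sqrt pi - 4 / (exp t * sqrt pi) > 0" using t by (simp add: field_simps)
    ultimately have "infinite {n. n \<ge> 1 \<and> BH_constant (n + 1) - BH_constant n
        < (4 / sqrt pi - 4 / (exp t * sqrt pi)) * real n powr (t / ln 2 + \<epsilon> - 1)}"
      by (rule small)
    moreover have "t / ln 2 + \<epsilon> - 1 = log 2 (exp t / 2) + \<epsilon>"
      by (simp add: log_def ln_div diff_divide_distrib)
    ultimately show "infinite {n. n \<ge> 1 \<and> BH_constant (n + 1) - BH_constant n
          < (4 / sqrt pi - 4 / (exp (1/2 - 1/2 * euler_mascheroni) * sqrt pi))
            * real n powr (log 2 (exp (1/2 - 1/2 * euler_mascheroni) / 2) + \<epsilon>)}"
      unfolding t_def by (simp only: not_False_eq_True)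
  }
  have exponent: "(0.304975::real) - 1 = - 0.695025" by simp
  have "infinite {n. n \<ge> 1 \<and> BH_constant (n + 1) - BH_constant n < 0.44 * real n powr (0.304975 - 1)}"
    by (rule small) simp_all
  then show "infinite {n. n \<ge> 1 \<and> BH_constant (n + 1) - BH_constant n < 0.44 / real n powr 0.695025}"
    unfolding exponent powr_minus divide_inverse[symmetric] .
qed

end
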